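(* Let $F\subset\mathbb{R}^3$ be a self-affine sponge, the attractor of $\{S_i\}_{i\in\mathcal I}$, and fix $\varepsilon\in(0,1)$. There is a constant $K>0$, depending only on the iterated function system and on $\varepsilon$, such that for all $\delta\in(0,1)$ and all $\mathbf i\in\mathcal I(\delta)$, $$N_\delta(S_{\mathbf i}(F))\le K\left(\frac{\alpha_1(\mathbf i)}{\alpha_2(\mathbf i)}\right)^{\overline{p_1}(\mathbf i)}\left(\frac{\alpha_2(\mathbf i)}{\alpha_3(\mathbf i)}\right)^{\overline{p_2}(\mathbf i)}\alpha_3(\mathbf i)^{-\varepsilon}.$$
   Context: **Sponges.** Let $\mathcal I$ be a finite set with at least two elements and let $\{S_i\}_{i\in\mathcal I}$ be affine contractions of $\mathbb{R}^3$ such that the linear part of each $S_i$ is a generalised permutation matrix (exactly one nonzero entry in each row and in each column) and $S_i([0,1]^3)\subset[0,1]^3$. The attractor $F$ is the unique non-empty compact set with $F=\bigcup_{i\in\mathcal I}S_i(F)$, and is called a self-affine sponge. **Words.** $\mathcal I^*=\bigcup_{n\ge1}\mathcal I^n$; for $\mathbf i=i_1\cdots i_n$, $S_{\mathbf i}=S_{i_1}\circ\cdots\circ S_{i_n}$, and $\alpha_1(\mathbf i)\ge\alpha_2(\mathbf i)\ge\alpha_3(\mathbf i)$ are the singular values of the linear part of $S_{\mathbf i}$. For $\delta\in(0,1)$, $\mathcal I(\delta)=\{\mathbf i\in\mathcal I^*:\alpha_3(\mathbf i)\le\delta<\alpha_3(\mathbf i^-)\}$, where $\mathbf i^-=i_1\cdots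 i_{k-1}$ for $\mathbf i=i_1\cdots i_k$ (with $\alpha_3=1$ for the empty word). **Dimensions.** $N_\delta(E)$ is the minimum number of boxes (cubes) of sidelength $\delta$ needed to cover $E$; $\overline{\dim}_{\mathrm B}E=\limsup_{\delta\to0}\log N_\delta(E)/(-\log\delta)$. The quasi-Assouad dimension is $\dim_{\mathrm{qA}}E=\lim_{\varepsilon\to0}h_E(\varepsilon)$, where $h_E(\varepsilon)$ is the infimum of those $\alpha$ for which there is $C>0$ with $N_r(B(x,R)\cap E)\le C(R/r)^\alpha$ for all $0<r\le R^{1+\varepsilon}<1$ and $x\in E$. **Projections.** For $\mathbf i\in\mathcal I^*$ let $\pi^1_{\mathbf i}$ be the projection onto the coordinate axis parallel to the longest edges of the cuboid $S_{\mathbf i}([0,1]^3)$, and $\pi^2_{\mathbf i}$ the projection onto the coordinate plane perpendicular to its shortest edges (if these are not unique, choose one possibility arbitrarily). Put $\overline{p_1}(\mathbf i)=\dim_{\mathrm{qA}}\pi^1_{\mathbf i}F$ and $\overline{p_2}(\mathbf i)=\overline{\dim}_{\mathrm B}\pi^2_{\mathbf i}F$. *)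

theory Defs
  imports "HOL-Analysis.Analysis" "HOL-Computational_Algebra.Polynomial"
begin

section \<open>Singular values\<close>

text \<open>
  The square roots of the eigenvalues of the Gram matrix \<open>A\<^sup>T A\<close>, in non-increasing order and
  repeated according to algebraic multiplicity; the determinant below is the characteristic
  polynomial of \<open>A\<^sup>T A\<close> evaluated at \<open>x\<close>.
\<close>

definition is_singular_values :: "real^'n^'n \<Rightarrow> real list \<Rightarrow> bool" where
  "is_singular_values A ss \<longleftrightarrow>
     length ss = CARD('n) \<and> sorted_wrt (\<ge>) ss \<and> (\<forall>s\<in>set ss. 0 \<le> s) \<and>
     (\<forall>x. det (mat x - transpose A ** A) = (\<Prod>s\<leftarrow>ss. x - s\<^sup>2))"

definition singular_values :: "real^'n^'n \<Rightarrow> real list" where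
  "singular_values A = (THE ss. is_singular_values A ss)"

lemma is_singular_values_unique:
  fixes A :: "real^'n^'n"
  assumes "is_singular_values A ss" "is_singular_values A ts"
  shows "ss = ts"
proof -
  define p where "p ss = (\<Prod>s\<in>#mset ss. [:- (s\<^sup>2), 1:])" for ss :: "real list"
  have poly_p: "poly (p ss) x = (\<Prod>s\<leftarrow>ss. x - s\<^sup>2)" for ss :: "real list" and x
    unfolding p_def by (induction ss) (auto simp: algebra_simps)
  have nonzero: "p ss \<noteq> 0" for ss
    unfolding p_def by auto
  have "proots (p ss) = image_mset power2 (mset ss)" for ss
  proof (induction ss)
    case (Cons s ss)
    have "proots (p (s # ss)) = proots ([:- (s\<^sup>2), 1:] * p ss)"
      unfolding p_def by (simp only: mset.simps image_mset_add_mset prod_mset.add_mset)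
    also have "\<dots> = proots [:- (s\<^sup>2), 1:] + proots (p ss)"
      using nonzero[of ss] by (intro proots_mult) auto
    finally show ?case using Cons by simp
  qed (simp add: p_def)
  moreover have "p ss = p ts"
  proof -
    have "poly (p ss) x = poly (p ts) x" for x
      using assms unfolding poly_p is_singular_values_def by metis
    then show ?thesis by (intro poly_eq_poly_eq_iff[THEN iffD1] ext)
  qed
  ultimately have eq: "image_mset power2 (mset ss) = image_mset power2 (mset ts)" by metis
  have sqrts: "image_mset sqrt (image_mset power2 (mset us)) = mset us"
    if "\<forall>s\<in>set us. 0 \<le> s" for us :: "real list"
    using that by (induction us) auto
  have "mset ss = mset ts"
    using sqrts[of ss] sqrts[of ts] eq assms unfolding is_singular_values_def by metis
  then have "mset (rev ss) = mset (rev ts)" by simp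
  moreover have "sorted (rev ss)" "sorted (rev ts)"
    using assms by (auto simp: is_singular_values_def sorted_wrt_rev)
  ultimately have "rev ss = rev ts"
    by (metis properties_for_sort)
  then show ?thesis by simp
qed

lemma singular_values_eqI: "is_singular_values A ss \<Longrightarrow> singular_values A = ss"
  unfolding singular_values_def by (blast intro: is_singular_values_unique)


section \<open>Self-affine sponges\<close>

definition generalised_permutation_matrix :: "real^'n^'n \<Rightarrow> bool" where
  "generalised_permutation_matrix A \<longleftrightarrow>
     (\<forall>i. \<exists>!j. A $ i $ j \<noteq> 0) \<and> (\<forall>j. \<exists>!i. A $ i $ j \<noteq> 0)"

definition affine_map :: "(real^'n \<Rightarrow> real^'n) \<Rightarrow> bool" where
  "affine_map f \<longleftrightarrow> (\<exists>A t. \<forall>x. f x = A *v x + t)"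

definition linear_part :: "(real^'n \<Rightarrow> real^'n) \<Rightarrow> real^'n^'n" where
  "linear_part f = matrix (\<lambda>x. f x - f 0)"

lemma linear_part_affine: "linear_part (\<lambda>x. A *v x + t) = A"
  by (simp add: linear_part_def)

abbreviation unit_cube :: "(real^3) set" where
  "unit_cube \<equiv> cbox 0 One"

definition sponge_ifs :: "'i set \<Rightarrow> ('i \<Rightarrow> real^3 \<Rightarrow> real^3) \<Rightarrow> bool" where
  "sponge_ifs I S \<longleftrightarrow>
     finite I \<and> 2 \<le> card I \<and>
     (\<forall>i\<in>I. affine_map (S i) \<and> (\<exists>c<1. c-lipschitz_on UNIV (S i)) \<and>
            generalised_permutation_matrix (linear_part (S i)) \<and>
            S i ` unit_cube \<subseteq> unit_cube)"

definition is_attractor :: "'i set \<Rightarrow> ('i \<Rightarrow> real^3 \<Rightarrow> real^3) \<Rightarrow> (real^3) set \<Rightarrow> bool" where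
  "is_attractor I S F \<longleftrightarrow> compact F \<and> F \<noteq> {} \<and> F = (\<Union>i\<in>I. S i ` F)"


section \<open>Words\<close>

definition words :: "'i set \<Rightarrow> 'i list set" where
  "words I = lists I - {[]}"

definition word_map :: "('i \<Rightarrow> 'a \<Rightarrow> 'a) \<Rightarrow> 'i list \<Rightarrow> 'a \<Rightarrow> 'a" where
  "word_map S w = foldr (\<circ>) (map S w) id"

text \<open>
  The index \<open>k\<close> ranges over \<open>1, 2, 3\<close>. On the empty word \<open>word_map S\<close> is the identity, whose
  singular values are all \<open>1\<close>.
\<close>

definition alpha :: "('i \<Rightarrow> real^3 \<Rightarrow> real^3) \<Rightarrow> nat \<Rightarrow> 'i list \<Rightarrow> real" where
  "alpha S k w = singular_values (linear_part (word_map S w)) ! (k - 1)"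

definition stopping :: "'i set \<Rightarrow> ('i \<Rightarrow> real^3 \<Rightarrow> real^3) \<Rightarrow> real \<Rightarrow> 'i list set" where
  "stopping I S \<delta> = {w \<in> words I. alpha S 3 w \<le> \<delta> \<and> \<delta> < alpha S 3 (butlast w)}"


section \<open>Dimensions\<close>

text \<open>
  Cubes are closed and have their edges parallel to the coordinate axes. The value is meaningful
  for bounded \<open>E\<close> and \<open>\<delta> > 0\<close>, when finite covers exist.
\<close>

definition covering_number :: "real \<Rightarrow> 'a::euclidean_space set \<Rightarrow> nat" where
  "covering_number \<delta> E =
     Inf {card A | A. finite A \<and> E \<subseteq> (\<Union>a\<in>A. cbox a (a + \<delta> *\<^sub>R One))}"

definition upper_box_dim :: "'a::euclidean_space set \<Rightarrow> ereal" where
  "upper_box_dim E =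
     Limsup (at_right 0) (\<lambda>\<delta>. ereal (ln (real (covering_number \<delta> E)) / (- ln \<delta>)))"

definition qA_exponent :: "'a::euclidean_space set \<Rightarrow> real \<Rightarrow> ereal" where
  "qA_exponent E \<epsilon> =
     Inf {ereal a | a. \<exists>C>0. \<forall>r R. \<forall>x\<in>E.
            0 < r \<and> 0 < R \<and> r \<le> R powr (1 + \<epsilon>) \<and> R powr (1 + \<epsilon>) < 1 \<longrightarrow>
            real (covering_number r (ball x R \<inter> E)) \<le> C * (R / r) powr a}"

text \<open>The limit exists because \<open>qA_exponent E\<close> is non-increasing on the positive reals.\<close>

definition quasi_Assouad_dim :: "'a::euclidean_space set \<Rightarrow> ereal" where
  "quasi_Assouad_dim E = Lim (at_right 0) (qA_exponent E)"


section \<open>Projections\<close>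

text \<open>
  Projections are taken as maps of \<open>\<real>\<^sup>3\<close> into itself. A subset of a coordinate axis or plane has
  the same covering numbers by cubes of \<open>\<real>\<^sup>3\<close> as by intervals or squares of that axis or
  plane, so its dimensions are unaffected.
\<close>

definition axis_proj :: "3 \<Rightarrow> real^3 \<Rightarrow> real^3" where
  "axis_proj j x = axis j (x $ j)"

definition plane_proj :: "3 \<Rightarrow> real^3 \<Rightarrow> real^3" where
  "plane_proj j x = x - axis j (x $ j)"

definition edge_length :: "(real^3) set \<Rightarrow> 3 \<Rightarrow> real" where
  "edge_length Q j = diameter ((\<lambda>x. x $ j) ` Q)"

text \<open>
  Selections, for every word, of a coordinate direction of the longest (shortest) edges of the
  cuboid \<open>S\<^sub>w([0,1]\<^sup>3)\<close>; any choice is allowed where there are several.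
\<close>

definition longest_choice :: "'i set \<Rightarrow> ('i \<Rightarrow> real^3 \<Rightarrow> real^3) \<Rightarrow> ('i list \<Rightarrow> 3) \<Rightarrow> bool" where
  "longest_choice I S a \<longleftrightarrow>
     (\<forall>w\<in>words I. \<forall>j. edge_length (word_map S w ` unit_cube) j
                        \<le> edge_length (word_map S w ` unit_cube) (a w))"

definition shortest_choice :: "'i set \<Rightarrow> ('i \<Rightarrow> real^3 \<Rightarrow> real^3) \<Rightarrow> ('i list \<Rightarrow> 3) \<Rightarrow> bool" where
  "shortest_choice I S b \<longleftrightarrow>
     (\<forall>w\<in>words I. \<forall>j. edge_length (word_map S w ` unit_cube) (b w)
                        \<le> edge_length (word_map S w ` unit_cube) j)"

text \<open>Both dimensions are finite for the non-empty bounded sets to which they are applied.\<close>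

definition p1_bar :: "(real^3) set \<Rightarrow> ('i list \<Rightarrow> 3) \<Rightarrow> 'i list \<Rightarrow> real" where
  "p1_bar F a w = real_of_ereal (quasi_Assouad_dim (axis_proj (a w) ` F))"

definition p2_bar :: "(real^3) set \<Rightarrow> ('i list \<Rightarrow> 3) \<Rightarrow> 'i list \<Rightarrow> real" where
  "p2_bar F b w = real_of_ereal (upper_box_dim (plane_proj (b w) ` F))"

end

theory Submission
  imports Defs
begin

text \<open>
  Let \<open>w\<close> be a word whose map stretches the output coordinates \<open>i\<^sub>1, i\<^sub>2, i\<^sub>3\<close> by \<open>\<alpha>\<^sub>1 \<ge> \<alpha>\<^sub>2 \<ge> \<alpha>\<^sub>3\<close>, and say
  that it reads these coordinates off the input coordinates \<open>j\<^sub>1, j\<^sub>2, j\<^sub>3\<close>. Since \<open>\<alpha>\<^sub>3 \<le> \<delta>\<close>, it is enough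
  to cover the image of \<open>F\<close> by cubes of side \<open>\<rho> = \<alpha>\<^sub>3 / 4\<close>, where the \<open>4\<close> keeps the scales below away
  from \<open>1\<close>. Pulled back to \<open>F\<close>, this asks for boxes of sides \<open>r = \<rho> / \<alpha>\<^sub>1\<close>, \<open>R = \<rho> / \<alpha>\<^sub>2\<close> and \<open>1 / 4\<close> in the
  directions \<open>j\<^sub>1, j\<^sub>2, j\<^sub>3\<close>. The third direction costs a constant. The projection of \<open>F\<close> along it is
  covered by squares of side \<open>R\<close>, and the upper box dimension controls how many; over each square, \<open>F\<close>
  is confined to an interval of length \<open>R\<close> in direction \<open>j\<^sub>1\<close>, and the quasi-Assouad dimension of the
  projection to that axis controls how many intervals of length \<open>r\<close> are needed there. As
  \<open>R / r = \<alpha>\<^sub>1 / \<alpha>\<^sub>2\<close> and \<open>1 / R\<close> is \<open>4 \<alpha>\<^sub>2 / \<alpha>\<^sub>3\<close>, the product of the two counts is the asserted bound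
  (\<open>covering_number_monomial_affine_le\<close>). The slack in both dimensions is paid for by the last
  factor, a power of \<open>\<alpha>\<^sub>3\<close> with exponent \<open>-\<epsilon>\<close>. The slack also absorbs the scales excluded in the
  definition of the quasi-Assouad dimension: there \<open>R / r\<close> is at most a small negative power of \<open>r\<close>,
  so the trivial volume bound suffices (\<open>covering_number_le_quasi_Assouad_dim\<close>).

  One point is hidden in the notation. The counts concern projections of \<open>F\<close> onto axis \<open>j\<^sub>1\<close> and along
  axis \<open>j\<^sub>3\<close>, directions of edges of the unit cube, whereas the exponents are dimensions of
  projections onto axis \<open>i\<^sub>1\<close> and along axis \<open>i\<^sub>3\<close>, directions of edges of the image cuboid. But the
  image of \<open>F\<close> lies in \<open>F\<close>, so the projection of \<open>F\<close> onto axis \<open>i\<^sub>1\<close> contains a similar copy of the one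
  onto axis \<open>j\<^sub>1\<close>, and the projection along \<open>i\<^sub>3\<close> contains a bi-Lipschitz copy of the one along \<open>j\<^sub>3\<close>. The
  distortion of these copies depends on the word, but only the pair of directions matters for the
  resulting bound; fixing one word for each of the finitely many pairs that occur gives constants
  that do not depend on the word (\<open>axis_proj_covering_bound\<close>, \<open>plane_proj_covering_bound\<close>).

  Ties between edge lengths are harmless. The ordering of the directions is chosen to end in the
  selected shortest one; then the selected longest direction is \<open>i\<^sub>1\<close> unless \<open>\<alpha>\<^sub>1 = \<alpha>\<^sub>2\<close>, in which case
  the power with base \<open>\<alpha>\<^sub>1 / \<alpha>\<^sub>2\<close> is \<open>1\<close> for every exponent.
\<close>

section \<open>Covering numbers and labellings\<close>

text \<open>
  Closeness in the maximum norm. A set lies in a cube of side \<open>r\<close> exactly when any two of its points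
  are close in this sense, so a cover by \<open>n\<close> cubes is the same as a labelling of the points with \<open>n\<close>
  labels in which equally labelled points are close. Labellings compose and multiply, which makes
  them easier to manipulate than explicit families of cubes.
\<close>

definition box_close :: "real \<Rightarrow> 'a::euclidean_space \<Rightarrow> 'a \<Rightarrow> bool" where
  "box_close r x y \<longleftrightarrow> (\<forall>b\<in>Basis. \<bar>x \<bullet> b - y \<bullet> b\<bar> \<le> r)"

lemma box_close_cart: "box_close r (x::real^'n) y \<longleftrightarrow> (\<forall>i. \<bar>x $ i - y $ i\<bar> \<le> r)"
  unfolding box_close_def
  by (auto simp: Basis_vec_def cart_eq_inner_axis)

lemma cube_of_box_close:
  fixes D :: "'a::euclidean_space set"
  assumes "\<And>x y. x \<in> D \<Longrightarrow> y \<in> D \<Longrightarrow> box_close r x y"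
  shows "\<exists>a. D \<subseteq> cbox a (a + r *\<^sub>R One)"
proof (cases "D = {}")
  case False
  then obtain z where z: "z \<in> D" by blast
  define a where "a = (\<Sum>b\<in>Basis. (INF x\<in>D. x \<bullet> b) *\<^sub>R b)"
  have ab: "a \<bullet> b = (INF x\<in>D. x \<bullet> b)" if "b \<in> Basis" for b
    using that by (simp add: a_def inner_sum_left_Basis)
  have "x \<in> cbox a (a + r *\<^sub>R One)" if x: "x \<in> D" for x
  proof -
    have "a \<bullet> b \<le> x \<bullet> b \<and> x \<bullet> b \<le> (a + r *\<^sub>R One) \<bullet> b" if b: "b \<in> Basis" for b
    proof
      have "x \<bullet> b - r \<le> y \<bullet> b" if "y \<in> D" for y
        using assms[OF x that] b unfolding box_close_def by (smt (verit))
      then have lower: "x \<bullet> b - r \<le> (INF y\<in>D. y \<bullet> b)"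
        using z by (intro cINF_greatest) auto
      have "bdd_below ((\<lambda>y. y \<bullet> b) ` D)"
        using assms[OF x] b unfolding box_close_def
        by (intro bdd_belowI2[where m = "x \<bullet> b - r"]) (smt (verit))
      then show "a \<bullet> b \<le> x \<bullet> b"
        unfolding ab[OF b] using x by (intro cINF_lower)
      show "x \<bullet> b \<le> (a + r *\<^sub>R One) \<bullet> b"
        using lower ab[OF b] b by (simp add: inner_add_left)
    qed
    then show ?thesis by (simp add: mem_box)
  qed
  then show ?thesis by blast
qed auto

lemma cover_of_labels:
  fixes f :: "'b \<Rightarrow> 'a::euclidean_space"
  assumes "finite J" and "l ` X \<subseteq> J"
    and close: "\<And>x y. x \<in> X \<Longrightarrow> y \<in> X \<Longrightarrow> l x = l y \<Longrightarrow> box_close r (f x) (f y)"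
  obtains A where "finite A" "card A \<le> card J" "f ` X \<subseteq> (\<Union>a\<in>A. cbox a (a + r *\<^sub>R One))"
proof -
  have "\<exists>a. f ` {x \<in> X. l x = j} \<subseteq> cbox a (a + r *\<^sub>R One)" for j
    using close by (intro cube_of_box_close) auto
  then obtain a where a: "\<And>j. f ` {x \<in> X. l x = j} \<subseteq> cbox (a j) (a j + r *\<^sub>R One)"
    by metis
  show thesis
  proof
    show "finite (a ` J)" "card (a ` J) \<le> card J"
      using assms(1) by (auto intro: card_image_le)
    show "f ` X \<subseteq> (\<Union>a\<in>a ` J. cbox a (a + r *\<^sub>R One))"
      using a assms(2) by fast
  qed
qed

text \<open>
  The labelled points may be parameters of the set to be covered, so that the points of an image
  can be labelled through their preimages.
\<close>

lemma covering_number_le_card: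
  fixes f :: "'b \<Rightarrow> 'a::euclidean_space"
  assumes "finite J" and "l ` X \<subseteq> J"
    and "\<And>x y. x \<in> X \<Longrightarrow> y \<in> X \<Longrightarrow> l x = l y \<Longrightarrow> box_close r (f x) (f y)"
  shows "covering_number r (f ` X) \<le> card J"
proof -
  obtain A where "finite A" "card A \<le> card J" "f ` X \<subseteq> (\<Union>a\<in>A. cbox a (a + r *\<^sub>R One))"
    using cover_of_labels[OF assms] .
  then have "covering_number r (f ` X) \<le> card A"
    unfolding covering_number_def by (intro cInf_lower) auto
  with \<open>card A \<le> card J\<close> show ?thesis by simp
qed

text \<open>
  The label of a point is its cell in the grid of mesh \<open>r\<close>. The existence of some finite labelling
  is essential: the infimum in \<open>covering_number\<close> is a minimum only over a non-empty set.
\<close>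

lemma grid_labels:
  fixes E :: "'a::euclidean_space set"
  assumes "E \<subseteq> cball x \<rho>" and "0 \<le> \<rho>" and "0 < r"
  obtains J :: "('a \<Rightarrow> int) set" and l where "finite J" "l ` E \<subseteq> J"
    "\<And>y z. y \<in> E \<Longrightarrow> z \<in> E \<Longrightarrow> l y = l z \<Longrightarrow> box_close r y z"
    "real (card J) \<le> (2 * \<rho> / r + 2) ^ DIM('a)"
proof
  define l where "l y = (\<lambda>b\<in>Basis. \<lfloor>(y - x) \<bullet> b / r\<rfloor>)" for y
  define J where "J = (PiE Basis (\<lambda>_. {\<lfloor>- \<rho> / r\<rfloor>..\<lfloor>\<rho> / r\<rfloor>}) :: ('a \<Rightarrow> int) set)"
  show "finite J"
    unfolding J_def by (intro finite_PiE) auto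
  show "l ` E \<subseteq> J"
  proof
    fix j assume "j \<in> l ` E"
    then obtain y where y: "y \<in> E" "j = l y" by blast
    have "\<lfloor>(y - x) \<bullet> b / r\<rfloor> \<in> {\<lfloor>- \<rho> / r\<rfloor>..\<lfloor>\<rho> / r\<rfloor>}" if b: "b \<in> Basis" for b
    proof -
      have "\<bar>(y - x) \<bullet> b\<bar> \<le> norm (y - x)" using b by (rule Basis_le_norm)
      also have "\<dots> \<le> \<rho>" using y assms(1) by (auto simp: dist_norm norm_minus_commute)
      finally have "- \<rho> \<le> (y - x) \<bullet> b" "(y - x) \<bullet> b \<le> \<rho>" by auto
      then show ?thesis
        unfolding atLeastAtMost_iff using \<open>0 < r\<close> by (intro conjI floor_mono divide_right_mono) auto
    qed
    then show "j \<in> J"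
      unfolding J_def y l_def by (intro restrict_PiE_iff[THEN iffD2]) blast
  qed
  show "box_close r y z" if "l y = l z" for y z
    unfolding box_close_def
  proof
    fix b :: 'a assume b: "b \<in> Basis"
    then have "\<lfloor>(y - x) \<bullet> b / r\<rfloor> = \<lfloor>(z - x) \<bullet> b / r\<rfloor>"
      using fun_cong[OF that, of b] by (simp add: l_def)
    then have "\<bar>(y - x) \<bullet> b / r - (z - x) \<bullet> b / r\<bar> \<le> 1" by linarith
    also have "(y - x) \<bullet> b / r - (z - x) \<bullet> b / r = (y \<bullet> b - z \<bullet> b) / r"
      by (simp add: diff_divide_distrib inner_diff_left)
    finally show "\<bar>y \<bullet> b - z \<bullet> b\<bar> \<le> r"
      using \<open>0 < r\<close> by (simp add: abs_divide)
  qed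
  have "0 \<le> \<rho> / r" using assms by simp
  have "real (card {\<lfloor>- \<rho> / r\<rfloor>..\<lfloor>\<rho> / r\<rfloor>}) \<le> 2 * \<rho> / r + 2"
  proof -
    have "\<lfloor>- \<rho> / r\<rfloor> \<le> \<lfloor>\<rho> / r\<rfloor>" using \<open>0 \<le> \<rho> / r\<close> by (intro floor_mono) simp
    then have "real (card {\<lfloor>- \<rho> / r\<rfloor>..\<lfloor>\<rho> / r\<rfloor>}) = of_int \<lfloor>\<rho> / r\<rfloor> - of_int \<lfloor>- \<rho> / r\<rfloor> + 1"
      by simp
    also have "\<dots> \<le> \<rho> / r - (- \<rho> / r - 1) + 1" by linarith
    finally show ?thesis by simp
  qed
  then show "real (card J) \<le> (2 * \<rho> / r + 2) ^ DIM('a)"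
    unfolding J_def by (simp add: card_PiE power_mono)
qed

lemma covering_number_le_volume:
  fixes E :: "'a::euclidean_space set"
  assumes "E \<subseteq> cball x \<rho>" and "0 \<le> \<rho>" and "0 < r"
  shows "real (covering_number r E) \<le> (2 * \<rho> / r + 2) ^ DIM('a)"
proof -
  obtain J :: "('a \<Rightarrow> int) set" and l where "finite J" "l ` E \<subseteq> J"
    "\<And>y z. y \<in> E \<Longrightarrow> z \<in> E \<Longrightarrow> l y = l z \<Longrightarrow> box_close r y z"
    and J: "real (card J) \<le> (2 * \<rho> / r + 2) ^ DIM('a)"
    by (rule grid_labels[OF assms]) blast
  then have "covering_number r ((\<lambda>x. x) ` E) \<le> card J"
    by (intro covering_number_le_card)
  with J show ?thesis by simp
qed

text \<open>
  The converse of \<open>covering_number_le_card\<close>: an optimal cover labels each point by a cube that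
  contains it.
\<close>

lemma covering_number_labels:
  fixes E :: "'a::euclidean_space set"
  assumes "bounded E" and "0 < r"
  obtains A :: "'a set" and l where "finite A" "card A = covering_number r E" "l ` E \<subseteq> A"
    "\<And>x y. x \<in> E \<Longrightarrow> y \<in> E \<Longrightarrow> l x = l y \<Longrightarrow> box_close r x y"
proof -
  obtain x \<rho> where "E \<subseteq> cball x \<rho>" "0 \<le> \<rho>"
    using bounded_subset_ballD[OF \<open>bounded E\<close>, of 0] ball_subset_cball by (meson less_imp_le order_trans)
  then obtain J :: "('a \<Rightarrow> int) set" and l where J: "finite J" "l ` E \<subseteq> J"
    "\<And>y z. y \<in> E \<Longrightarrow> z \<in> E \<Longrightarrow> l y = l z \<Longrightarrow> box_close r y z"
    by (rule grid_labels[OF _ _ \<open>0 < r\<close>]) blast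
  let ?N = "{card A | A. finite A \<and> E \<subseteq> (\<Union>a\<in>A. cbox a (a + r *\<^sub>R One))}"
  obtain A where "finite A" "card A \<le> card J" "(\<lambda>x. x) ` E \<subseteq> (\<Union>a\<in>A. cbox a (a + r *\<^sub>R One))"
    by (rule cover_of_labels[OF J])
  then have "card A \<in> ?N" by auto
  then have "?N \<noteq> {}" by blast
  then have "covering_number r E \<in> ?N"
    unfolding covering_number_def by (rule Inf_nat_def1)
  then obtain A where A: "finite A" "card A = covering_number r E"
    "E \<subseteq> (\<Union>a\<in>A. cbox a (a + r *\<^sub>R One))"
    by auto
  define l where "l x = (SOME a. a \<in> A \<and> x \<in> cbox a (a + r *\<^sub>R One))" for x
  have l: "l x \<in> A \<and> x \<in> cbox (l x) (l x + r *\<^sub>R One)" if "x \<in> E" for x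
  proof -
    have "\<exists>a. a \<in> A \<and> x \<in> cbox a (a + r *\<^sub>R One)"
      using A(3) that by blast
    then show ?thesis unfolding l_def by (rule someI_ex)
  qed
  show thesis
  proof
    show "l ` E \<subseteq> A" using l by blast
    fix x y assume xy: "x \<in> E" "y \<in> E" "l x = l y"
    show "box_close r x y"
      unfolding box_close_def
    proof
      fix b :: 'a assume b: "b \<in> Basis"
      then have "x \<bullet> b \<in> {l x \<bullet> b..l x \<bullet> b + r}" "y \<bullet> b \<in> {l x \<bullet> b..l x \<bullet> b + r}"
        using l[OF xy(1)] l[OF xy(2)] xy(3) by (auto simp: mem_box inner_add_left)
      then show "\<bar>x \<bullet> b - y \<bullet> b\<bar> \<le> r" by auto
    qed
  qed (use A in auto)
qed

text \<open>
  Labels pull back along a map that does not contract too much. This is how covering numbers are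
  compared between a set and an affine copy of it inside another set.
\<close>

lemma covering_number_le_image:
  fixes E :: "'a::euclidean_space set" and E' :: "'b::euclidean_space set"
  assumes "bounded E'" and "0 < r'" and "g ` E \<subseteq> E'"
    and "\<And>x y. x \<in> E \<Longrightarrow> y \<in> E \<Longrightarrow> box_close r' (g x) (g y) \<Longrightarrow> box_close r x y"
  shows "covering_number r E \<le> covering_number r' E'"
proof -
  obtain A :: "'b set" and l where A: "finite A" "card A = covering_number r' E'" "l ` E' \<subseteq> A"
    "\<And>x y. x \<in> E' \<Longrightarrow> y \<in> E' \<Longrightarrow> l x = l y \<Longrightarrow> box_close r' x y"
    by (rule covering_number_labels[OF assms(1,2)]) blast
  have "covering_number r ((\<lambda>x. x) ` E) \<le> card A"
  proof (rule covering_number_le_card)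
    show "(l \<circ> g) ` E \<subseteq> A"
      using A(3) assms(3) by (auto simp: image_subset_iff)
    show "box_close r x y" if "x \<in> E" "y \<in> E" "(l \<circ> g) x = (l \<circ> g) y" for x y
      using assms(3) that by (intro assms(4) A(4)) auto
  qed (fact A(1))
  then show ?thesis using A(2) by simp
qed

lemma covering_number_antimono:
  fixes E :: "'a::euclidean_space set"
  assumes "bounded E" and "0 < r" and "r \<le> r'"
  shows "covering_number r' E \<le> covering_number r E"
proof (rule covering_number_le_image[where g = "\<lambda>x. x"])
  show "box_close r' x y" if "box_close r x y" for x y :: 'a
    unfolding box_close_def
  proof
    fix b :: 'a assume "b \<in> Basis"
    then have "\<bar>x \<bullet> b - y \<bullet> b\<bar> \<le> r" using that unfolding box_close_def by blast
    with \<open>r \<le> r'\<close> show "\<bar>x \<bullet> b - y \<bullet> b\<bar> \<le> r'" by linarith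
  qed
qed (use assms in auto)

lemma covering_number_ge_1:
  fixes E :: "'a::euclidean_space set"
  assumes "bounded E" and "0 < r" and "E \<noteq> {}"
  shows "1 \<le> covering_number r E"
proof -
  obtain A :: "'a set" and l where "finite A" "card A = covering_number r E" "l ` E \<subseteq> A"
    by (rule covering_number_labels[OF assms(1,2)])
  then have "card A \<noteq> 0" using assms(3) by (metis card_eq_0_iff image_is_empty subset_empty)
  then show ?thesis using \<open>card A = covering_number r E\<close> by linarith
qed

section \<open>Dimensions as bounds on covering numbers\<close>

text \<open>
  Finiteness is needed because \<open>real_of_ereal\<close> sends infinite values to \<open>0\<close>.
\<close>

lemma upper_box_dim_finite:
  fixes E :: "'a::euclidean_space set"
  assumes "bounded E" and "E \<noteq> {}"
  shows "0 \<le> upper_box_dim E" and "upper_box_dim E < \<infinity>"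
proof -
  have "\<forall>\<^sub>F \<delta> in at_right 0. 0 \<le> ereal (ln (real (covering_number \<delta> E)) / (- ln \<delta>))"
    unfolding eventually_at_right_field
  proof (intro exI[of _ 1] conjI allI impI)
    fix \<delta> :: real assume "0 < \<delta>" "\<delta> < 1"
    then show "0 \<le> ereal (ln (real (covering_number \<delta> E)) / (- ln \<delta>))"
      using covering_number_ge_1[OF assms(1) _ assms(2), of \<delta>] by (auto simp: divide_nonneg_neg)
  qed simp
  then show "0 \<le> upper_box_dim E"
    unfolding upper_box_dim_def by (intro le_Limsup) auto
  obtain \<rho> where \<rho>: "E \<subseteq> cball 0 \<rho>" "0 < \<rho>"
    using bounded_subset_ballD[OF assms(1), of 0] ball_subset_cball by (meson order_trans)
  define c where "c = 2 * \<rho> + 2"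
  have c: "2 < c" using \<rho> by (simp add: c_def)
  \<comment> \<open>Twice the ambient dimension, as the extra power of \<open>1 / \<delta>\<close> absorbs the constant \<open>c\<close>.\<close>
  have "\<forall>\<^sub>F \<delta> in at_right 0. ereal (ln (real (covering_number \<delta> E)) / (- ln \<delta>)) \<le> ereal (2 * DIM('a))"
    unfolding eventually_at_right_field
  proof (intro exI[of _ "1 / c"] conjI allI impI)
    fix \<delta> :: real assume \<delta>: "0 < \<delta>" "\<delta> < 1 / c"
    have "1 / c < 1" using c by simp
    with \<delta> have "\<delta> < 1" by linarith
    have "real (covering_number \<delta> E) \<le> (2 * \<rho> / \<delta> + 2) ^ DIM('a)"
      using \<rho> \<delta> by (intro covering_number_le_volume) auto
    also have "\<dots> \<le> ((1 / \<delta>) ^ 2) ^ DIM('a)"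
    proof (rule power_mono)
      have "2 * \<rho> / \<delta> + 2 \<le> c * (1 / \<delta>)"
        using \<delta> \<open>\<delta> < 1\<close> by (simp add: c_def field_simps)
      also have "\<dots> \<le> (1 / \<delta>) * (1 / \<delta>)"
        using \<delta> c by (intro mult_right_mono) (auto simp: field_simps)
      finally show "2 * \<rho> / \<delta> + 2 \<le> (1 / \<delta>) ^ 2" by (simp add: power2_eq_square)
    qed (use \<rho> \<delta> in auto)
    finally have "ln (real (covering_number \<delta> E)) \<le> ln ((1 / \<delta>) ^ (2 * DIM('a)))"
      using covering_number_ge_1[OF assms(1) _ assms(2), of \<delta>] \<delta> by (simp add: power_mult)
    also have "\<dots> = real (2 * DIM('a)) * (- ln \<delta>)"
      using \<delta> by (simp add: ln_realpow ln_div)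
    finally have "ln (real (covering_number \<delta> E)) \<le> real (2 * DIM('a)) * (- ln \<delta>)" .
    moreover have "0 < - ln \<delta>" using \<delta> \<open>\<delta> < 1\<close> by simp
    ultimately show "ereal (ln (real (covering_number \<delta> E)) / (- ln \<delta>)) \<le> ereal (2 * DIM('a))"
      by (simp only: pos_divide_le_eq ereal_less_eq)
  qed (use c in auto)
  then have "upper_box_dim E \<le> ereal (2 * DIM('a))"
    unfolding upper_box_dim_def by (rule Limsup_bounded)
  then show "upper_box_dim E < \<infinity>" by (cases "upper_box_dim E") auto
qed

text \<open>
  The limit superior gives the bound for small \<open>\<delta>\<close>. For larger \<open>\<delta>\<close> the covering number is bounded and
  the power of \<open>\<delta>\<close> is at least \<open>1\<close>, because the dimension is non-negative.
\<close>

lemma covering_number_le_upper_box_dim: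
  fixes E :: "'a::euclidean_space set"
  assumes "bounded E" and "E \<noteq> {}" and "0 < \<eta>"
  obtains C where "0 < C" "\<And>\<delta>. 0 < \<delta> \<Longrightarrow> \<delta> \<le> 1 \<Longrightarrow>
    real (covering_number \<delta> E) \<le> C * \<delta> powr - (real_of_ereal (upper_box_dim E) + \<eta>)"
proof -
  define s where "s = real_of_ereal (upper_box_dim E)"
  have s: "upper_box_dim E = ereal s" "0 \<le> s"
    using upper_box_dim_finite[OF assms(1,2)] by (cases "upper_box_dim E"; auto simp: s_def)+
  have "\<forall>\<^sub>F \<delta> in at_right 0. ereal (ln (real (covering_number \<delta> E)) / (- ln \<delta>)) < ereal (s + \<eta>)"
    using s \<open>0 < \<eta>\<close> unfolding upper_box_dim_def by (intro Limsup_lessD) simp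
  then obtain b where b: "0 < b"
    "\<And>\<delta>. 0 < \<delta> \<Longrightarrow> \<delta> < b \<Longrightarrow> ln (real (covering_number \<delta> E)) / (- ln \<delta>) < s + \<eta>"
    unfolding eventually_at_right_field by auto
  define d where "d = min b 1 / 2"
  have d: "0 < d" "d < b" "d < 1" using b by (auto simp: d_def)
  have small: "real (covering_number \<delta> E) \<le> \<delta> powr - (s + \<eta>)" if \<delta>: "0 < \<delta>" "\<delta> \<le> d" for \<delta>
  proof -
    have N: "0 < real (covering_number \<delta> E)"
      using covering_number_ge_1[OF assms(1) \<delta>(1) assms(2)] by simp
    have "0 < - ln \<delta>" using \<delta> d by simp
    moreover have "ln (real (covering_number \<delta> E)) / (- ln \<delta>) < s + \<eta>"
      using b(2) \<delta> d by simp
    ultimately have "ln (real (covering_number \<delta> E)) < (s + \<eta>) * (- ln \<delta>)"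
      by (simp only: pos_divide_less_eq)
    then have "ln (real (covering_number \<delta> E)) \<le> ln (\<delta> powr - (s + \<eta>))"
      using \<delta> by (simp add: ln_powr) (simp add: algebra_simps)
    then show ?thesis using N \<delta> by (subst (asm) ln_le_cancel_iff) auto
  qed
  define C where "C = 1 + real (covering_number d E)"
  have "real (covering_number \<delta> E) \<le> C * \<delta> powr - (s + \<eta>)" if \<delta>: "0 < \<delta>" "\<delta> \<le> 1" for \<delta>
  proof (cases "\<delta> \<le> d")
    case True
    then have "real (covering_number \<delta> E) \<le> 1 * \<delta> powr - (s + \<eta>)" using small \<delta> by simp
    also have "\<dots> \<le> C * \<delta> powr - (s + \<eta>)" by (intro mult_right_mono) (auto simp: C_def)
    finally show ?thesis .
  next
    case False
    then have "covering_number \<delta> E \<le> covering_number d E"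
      using assms d by (intro covering_number_antimono) auto
    then have "real (covering_number \<delta> E) \<le> C * 1" by (simp add: C_def)
    also have "\<dots> \<le> C * \<delta> powr - (s + \<eta>)"
      using s assms \<delta> powr_mono'[of "- (s + \<eta>)" 0 \<delta>] by (intro mult_left_mono) (auto simp: C_def)
    finally show ?thesis .
  qed
  then show thesis using that[of C] by (auto simp: C_def s_def)
qed

lemma powr_1_plus_le:
  assumes "0 < R" and "R < (1::real)" and "0 \<le> \<epsilon>"
  shows "R powr (1 + \<epsilon>) \<le> R"
  using powr_mono'[of 1 "1 + \<epsilon>" R] assms by simp

lemma powr_less_1_iff:
  assumes "0 < R" and "0 < (p::real)"
  shows "R powr p < 1 \<longleftrightarrow> R < 1"
  using assms powr_less_mono2[of p R 1] powr_mono2[of p 1 R] by (auto simp: not_le[symmetric])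

text \<open>
  A larger \<open>\<epsilon>\<close> leaves fewer pairs of scales to control.
\<close>

lemma qA_exponent_antimono:
  fixes E :: "'a::euclidean_space set"
  assumes "0 < \<epsilon>" and "\<epsilon> \<le> \<epsilon>'"
  shows "qA_exponent E \<epsilon>' \<le> qA_exponent E \<epsilon>"
  unfolding qA_exponent_def
proof (rule Inf_superset_mono, clarify)
  fix a C :: real
  assume "0 < C" and C: "\<forall>r R. \<forall>x\<in>E. 0 < r \<and> 0 < R \<and> r \<le> R powr (1 + \<epsilon>) \<and> R powr (1 + \<epsilon>) < 1 \<longrightarrow>
            real (covering_number r (ball x R \<inter> E)) \<le> C * (R / r) powr a"
  have "real (covering_number r (ball x R \<inter> E)) \<le> C * (R / r) powr a"
    if "x \<in> E" "0 < r" "0 < R" "r \<le> R powr (1 + \<epsilon>')" "R powr (1 + \<epsilon>') < 1" for r R x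
  proof -
    have "R < 1" using that assms powr_less_1_iff[of R "1 + \<epsilon>'"] by auto
    then have "R powr (1 + \<epsilon>') \<le> R powr (1 + \<epsilon>)" "R powr (1 + \<epsilon>) < 1"
      using that assms powr_less_1_iff[of R "1 + \<epsilon>"] by (auto intro: powr_mono')
    with that C show ?thesis by (meson order_trans)
  qed
  with \<open>0 < C\<close> show "\<exists>a'. ereal a = ereal a' \<and> (\<exists>C>0. \<forall>r R. \<forall>x\<in>E. 0 < r \<and> 0 < R \<and> r \<le> R powr (1 + \<epsilon>') \<and> R powr (1 + \<epsilon>') < 1 \<longrightarrow>
            real (covering_number r (ball x R \<inter> E)) \<le> C * (R / r) powr a')"
    by blast
qed

lemma qA_exponent_le_DIM:
  fixes E :: "'a::euclidean_space set"
  assumes "0 < \<epsilon>"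
  shows "qA_exponent E \<epsilon> \<le> ereal (real DIM('a))"
proof -
  have "real (covering_number r (ball x R \<inter> E)) \<le> 4 ^ DIM('a) * (R / r) powr real DIM('a)"
    if "0 < r" "0 < R" "r \<le> R powr (1 + \<epsilon>)" "R powr (1 + \<epsilon>) < 1" for r R x
  proof -
    have "r \<le> R"
      using that assms powr_less_1_iff[of R "1 + \<epsilon>"] powr_1_plus_le[of R \<epsilon>] by simp
    have "real (covering_number r (ball x R \<inter> E)) \<le> (2 * R / r + 2) ^ DIM('a)"
      using that by (intro covering_number_le_volume[where x = x]) auto
    also have "\<dots> \<le> (4 * (R / r)) ^ DIM('a)"
      using that \<open>r \<le> R\<close> by (intro power_mono) (auto simp: field_simps)
    also have "\<dots> = 4 ^ DIM('a) * (R / r) powr real DIM('a)"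
      using that by (simp add: powr_realpow power_mult_distrib power_divide)
    finally show ?thesis .
  qed
  then show ?thesis
    unfolding qA_exponent_def by (intro Inf_lower CollectI exI[of _ "real DIM('a)"] conjI refl exI[of _ "4 ^ DIM('a)"]) auto
qed

text \<open>
  With a negative exponent the bound would tend to \<open>0\<close> as \<open>r\<close> does for a fixed \<open>R\<close>, while at least one
  cube is always needed.
\<close>

lemma qA_exponent_nonneg:
  fixes E :: "'a::euclidean_space set"
  assumes "0 < \<epsilon>" and "E \<noteq> {}"
  shows "0 \<le> qA_exponent E \<epsilon>"
  unfolding qA_exponent_def
proof (intro Inf_greatest, clarify)
  fix a C :: real
  assume "0 < C" and C: "\<forall>r R. \<forall>x\<in>E. 0 < r \<and> 0 < R \<and> r \<le> R powr (1 + \<epsilon>) \<and> R powr (1 + \<epsilon>) < 1 \<longrightarrow>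
            real (covering_number r (ball x R \<inter> E)) \<le> C * (R / r) powr a"
  obtain x where x: "x \<in> E" using assms by blast
  have "0 \<le> a"
  proof (rule ccontr)
    assume "\<not> 0 \<le> a"
    define R :: real where "R = 1 / 2"
    have R: "0 < R" "R powr (1 + \<epsilon>) < 1"
      using assms powr_less_1_iff[of R "1 + \<epsilon>"] by (auto simp: R_def)
    have "((\<lambda>r. C * (R / r) powr a) \<longlongrightarrow> 0) (at_right 0)"
    proof (rule tendsto_mult_right_zero)
      have "filterlim (\<lambda>r. R / r) at_top (at_right 0)"
        unfolding divide_inverse using R
        by (intro filterlim_tendsto_pos_mult_at_top[OF tendsto_const] filterlim_inverse_at_top_right) auto
      then show "((\<lambda>r. (R / r) powr a) \<longlongrightarrow> 0) (at_right 0)"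
        using \<open>\<not> 0 \<le> a\<close> by (intro tendsto_neg_powr) auto
    qed
    then have "\<forall>\<^sub>F r in at_right 0. C * (R / r) powr a < 1"
      by (rule order_tendstoD) simp
    moreover have "\<forall>\<^sub>F r in at_right 0. r \<in> {0<..<R powr (1 + \<epsilon>)}"
      using R by (intro eventually_at_right_real) auto
    ultimately have "\<forall>\<^sub>F r in at_right 0. r \<in> {0<..<R powr (1 + \<epsilon>)} \<and> C * (R / r) powr a < 1"
      by eventually_elim auto
    then obtain r where r: "0 < r" "r < R powr (1 + \<epsilon>)" "C * (R / r) powr a < 1"
      using eventually_happens[of _ "at_right (0::real)"] by auto
    have "1 \<le> covering_number r (ball x R \<inter> E)"
      using x r R centre_in_ball[of x R] by (intro covering_number_ge_1) blast+
    moreover have "real (covering_number r (ball x R \<inter> E)) \<le> C * (R / r) powr a"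
      using C x r R by auto
    ultimately show False using r(3) by linarith
  qed
  then show "0 \<le> ereal a" by simp
qed

text \<open>
  By monotonicity the limit that defines the dimension is a supremum, hence an upper bound for the
  exponent at each single \<open>\<epsilon>\<close>.
\<close>

lemma quasi_Assouad_dim_eq_SUP:
  fixes E :: "'a::euclidean_space set"
  shows "quasi_Assouad_dim E = (SUP \<epsilon>\<in>{0<..}. qA_exponent E \<epsilon>)"
  unfolding quasi_Assouad_dim_def
proof (rule tendsto_Lim)
  show "(qA_exponent E \<longlongrightarrow> (SUP \<epsilon>\<in>{0<..}. qA_exponent E \<epsilon>)) (at_right 0)"
  proof (rule order_tendstoI)
    fix a assume "a < (SUP \<epsilon>\<in>{0<..}. qA_exponent E \<epsilon>)"
    then obtain b where b: "0 < b" "a < qA_exponent E b" by (auto simp: less_SUP_iff)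
    then have "a < qA_exponent E \<epsilon>" if "0 < \<epsilon>" "\<epsilon> < b" for \<epsilon>
      using that qA_exponent_antimono[of \<epsilon> b E] by (auto intro: less_le_trans)
    with b show "\<forall>\<^sub>F \<epsilon> in at_right 0. a < qA_exponent E \<epsilon>"
      unfolding eventually_at_right_field by auto
  next
    fix a assume a: "(SUP \<epsilon>\<in>{0<..}. qA_exponent E \<epsilon>) < a"
    have "qA_exponent E \<epsilon> < a" if "0 < \<epsilon>" for \<epsilon>
      using that by (intro le_less_trans[OF SUP_upper a]) auto
    then show "\<forall>\<^sub>F \<epsilon> in at_right 0. qA_exponent E \<epsilon> < a"
      unfolding eventually_at_right_field by (intro exI[of _ 1]) auto
  qed
qed simp

lemma quasi_Assouad_dim_finite:
  fixes E :: "'a::euclidean_space set"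
  assumes "E \<noteq> {}"
  shows "0 \<le> quasi_Assouad_dim E" and "quasi_Assouad_dim E < \<infinity>"
proof -
  have "qA_exponent E 1 \<le> quasi_Assouad_dim E"
    unfolding quasi_Assouad_dim_eq_SUP by (intro SUP_upper) auto
  with qA_exponent_nonneg[OF _ assms, of 1] show "0 \<le> quasi_Assouad_dim E" by simp
  have "quasi_Assouad_dim E \<le> ereal (real DIM('a))"
    unfolding quasi_Assouad_dim_eq_SUP by (intro SUP_least qA_exponent_le_DIM) auto
  then show "quasi_Assouad_dim E < \<infinity>" by (cases "quasi_Assouad_dim E") auto
qed

text \<open>
  The bound holds for all pairs of scales, not only for those separated by \<open>r \<le> R powr (1 + e)\<close>, at
  the price of the factor \<open>r powr - \<eta>\<close>. For scales that are not separated, \<open>R / r\<close> is at most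
  \<open>r powr - e\<close>, so the volume bound \<open>(6 R / r)\<^sup>n\<close> is at most a constant times \<open>r powr - \<eta>\<close> when
  \<open>e = \<eta> / n\<close>. Balls of radius \<open>2 R\<close> are used because two points of a cube of side \<open>R\<close> have projections
  to an axis at distance at most \<open>R\<close>, and the balls are open; \<open>R \<le> 1 / 4\<close> keeps this radius below \<open>1\<close>.
\<close>

lemma covering_number_le_quasi_Assouad_dim:
  fixes E :: "'a::euclidean_space set"
  assumes "E \<noteq> {}" and "0 < \<eta>"
  obtains C where "0 < C" "\<And>r R x. x \<in> E \<Longrightarrow> 0 < r \<Longrightarrow> r \<le> R \<Longrightarrow> R \<le> 1 / 4 \<Longrightarrow>
    real (covering_number r (ball x (2 * R) \<inter> E))
      \<le> C * (R / r) powr real_of_ereal (quasi_Assouad_dim E) * r powr - \<eta>"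
proof -
  define s where "s = real_of_ereal (quasi_Assouad_dim E)"
  have s: "quasi_Assouad_dim E = ereal s" "0 \<le> s"
    using quasi_Assouad_dim_finite[OF assms(1)] by (cases "quasi_Assouad_dim E"; auto simp: s_def)+
  define n where "n = DIM('a)"
  have "0 < n" by (simp add: n_def)
  define e where "e = \<eta> / n"
  have e: "0 < e" using assms by (simp add: e_def \<open>0 < n\<close>)
  have "qA_exponent E e \<le> quasi_Assouad_dim E"
    unfolding quasi_Assouad_dim_eq_SUP using e by (intro SUP_upper) auto
  also have "\<dots> < ereal (s + \<eta>)" using s assms by simp
  finally obtain a C where "a < s + \<eta>" "0 < C" and C: "\<forall>r R. \<forall>x\<in>E.
      0 < r \<and> 0 < R \<and> r \<le> R powr (1 + e) \<and> R powr (1 + e) < 1 \<longrightarrow>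
      real (covering_number r (ball x R \<inter> E)) \<le> C * (R / r) powr a"
    unfolding qA_exponent_def Inf_less_iff by auto
  define K where "K = C * 2 powr (s + \<eta>) + 6 ^ n"
  have "real (covering_number r (ball x (2 * R) \<inter> E)) \<le> K * (R / r) powr s * r powr - \<eta>"
    if x: "x \<in> E" and r: "0 < r" "r \<le> R" "R \<le> 1 / 4" for r R x
  proof -
    have R: "0 < R" using r by linarith
    have ge1: "1 \<le> R / r" using r by simp
    have R2: "(2 * R) powr (1 + e) < 1" using r R e powr_less_1_iff[of "2 * R" "1 + e"] by auto
    have nonneg: "0 \<le> (R / r) powr s * r powr - \<eta>" by simp
    show ?thesis
    proof (cases "r \<le> (2 * R) powr (1 + e)")
      case True
      have "real (covering_number r (ball x (2 * R) \<inter> E)) \<le> C * (2 * R / r) powr a"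
        using C x r R R2 True by auto
      also have "\<dots> \<le> C * (2 * R / r) powr (s + \<eta>)"
        using \<open>0 < C\<close> \<open>a < s + \<eta>\<close> r R by (intro mult_left_mono powr_mono) (auto simp: field_simps)
      also have "\<dots> = C * (2 * (R / r)) powr (s + \<eta>)" by simp
      also have "\<dots> = C * 2 powr (s + \<eta>) * (R / r) powr s * (R / r) powr \<eta>"
        using r R unfolding powr_mult powr_add by (simp add: mult_ac)
      also have "\<dots> \<le> C * 2 powr (s + \<eta>) * (R / r) powr s * (1 / r) powr \<eta>"
        using \<open>0 < C\<close> r R assms(2) by (intro mult_left_mono powr_mono2 divide_right_mono) auto
      also have "\<dots> = C * 2 powr (s + \<eta>) * ((R / r) powr s * r powr - \<eta>)"
        using r by (simp add: powr_divide powr_minus_divide)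
      also have "\<dots> \<le> K * ((R / r) powr s * r powr - \<eta>)"
        using nonneg by (intro mult_right_mono) (auto simp: K_def)
      finally show ?thesis by (simp add: mult.assoc)
    next
      case False
      have "R / r \<le> (2 * R) / (2 * R) powr (1 + e)"
        using False r R by (intro frac_le) auto
      also have "\<dots> = (2 * R) powr - e"
        using R by (simp add: powr_add powr_minus_divide)
      also have "\<dots> \<le> r powr - e"
        using r R e by (intro powr_mono2') auto
      finally have Rr: "R / r \<le> r powr - e" .
      have "real (covering_number r (ball x (2 * R) \<inter> E)) \<le> (2 * (2 * R) / r + 2) ^ n"
        unfolding n_def using r R by (intro covering_number_le_volume[where x = x]) auto
      also have "\<dots> \<le> (6 * (R / r)) ^ n"
        using r R by (intro power_mono) (auto simp: field_simps)
      also have "\<dots> \<le> (6 * r powr - e) ^ n"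
        using r R Rr by (intro power_mono mult_left_mono) auto
      also have "\<dots> = 6 ^ n * (1 * r powr - \<eta>)"
        using r \<open>0 < n\<close> by (simp add: power_mult_distrib powr_realpow[symmetric] powr_powr e_def)
      also have "\<dots> \<le> 6 ^ n * ((R / r) powr s * r powr - \<eta>)"
        using ge1 s powr_mono2[of s 1 "R / r"] by (intro mult_left_mono mult_right_mono) auto
      also have "\<dots> \<le> K * ((R / r) powr s * r powr - \<eta>)"
        using nonneg \<open>0 < C\<close> by (intro mult_right_mono) (auto simp: K_def)
      finally show ?thesis by (simp add: mult.assoc)
    qed
  qed
  moreover have "0 < K" using \<open>0 < C\<close> by (auto simp: K_def intro: add_pos_pos)
  ultimately show thesis using that[of K] by (auto simp: s_def)
qed

section \<open>Maps with a generalised permutation matrix as linear part\<close>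

text \<open>
  Output coordinate \<open>i\<close> is an affine function of input coordinate \<open>\<tau> i\<close>. Keeping \<open>\<tau>\<close> explicit separates
  the direction \<open>i\<close> of an edge of the image cuboid from the direction \<open>\<tau> i\<close> of the edge of the unit
  cube that is mapped to it.
\<close>

definition monomial_affine ::
  "(real^'n \<Rightarrow> real^'n) \<Rightarrow> ('n \<Rightarrow> 'n) \<Rightarrow> ('n \<Rightarrow> real) \<Rightarrow> real^'n \<Rightarrow> bool" where
  "monomial_affine f \<tau> c t \<longleftrightarrow>
     bij \<tau> \<and> (\<forall>i. c i \<noteq> 0) \<and> (\<forall>x i. f x $ i = c i * x $ \<tau> i + t $ i)"

lemma monomial_affine_of_generalised_permutation:
  assumes "affine_map f" and "generalised_permutation_matrix (linear_part f)"
  obtains \<tau> c t where "monomial_affine f \<tau> c t"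
proof -
  obtain A t where f: "f = (\<lambda>x. A *v x + t)"
    using assms(1) unfolding affine_map_def by auto
  have row: "\<exists>!j. A $ i $ j \<noteq> 0" and col: "\<exists>!i. A $ i $ j \<noteq> 0" for i j
    using assms(2) unfolding f linear_part_affine generalised_permutation_matrix_def by auto
  define \<tau> where "\<tau> i = (THE j. A $ i $ j \<noteq> 0)" for i
  have \<tau>: "A $ i $ \<tau> i \<noteq> 0" for i
    unfolding \<tau>_def by (rule theI'[OF row])
  have \<tau>_eq: "j = \<tau> i" if "A $ i $ j \<noteq> 0" for i j
    using row[of i] \<tau> that by blast
  have "bij \<tau>"
  proof -
    have "inj \<tau>"
    proof (rule injI)
      fix i k assume "\<tau> i = \<tau> k"
      then have "A $ k $ \<tau> i \<noteq> 0" using \<tau>[of k] by simp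
      then show "i = k" using col[of "\<tau> i"] \<tau>[of i] by blast
    qed
    then show ?thesis by (simp add: bij_def finite_UNIV_inj_surj)
  qed
  moreover have "f x $ i = A $ i $ \<tau> i * x $ \<tau> i + t $ i" for x i
  proof -
    have "(\<Sum>j\<in>UNIV. A $ i $ j * x $ j) = (\<Sum>j\<in>{\<tau> i}. A $ i $ j * x $ j)"
      using \<tau>_eq by (intro sum.mono_neutral_right) auto
    then show ?thesis by (simp add: f matrix_vector_mult_def)
  qed
  ultimately have "monomial_affine f \<tau> (\<lambda>i. A $ i $ \<tau> i) t"
    using \<tau> by (simp add: monomial_affine_def)
  then show thesis by (rule that)
qed

lemma monomial_affine_id: "monomial_affine id id (\<lambda>_. 1) 0"
  by (simp add: monomial_affine_def)

lemma monomial_affine_comp: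
  assumes "monomial_affine f \<tau> c t" and "monomial_affine g \<sigma> d u"
  shows "monomial_affine (f \<circ> g) (\<sigma> \<circ> \<tau>) (\<lambda>i. c i * d (\<tau> i)) (\<chi> i. c i * u $ \<tau> i + t $ i)"
  using assms unfolding monomial_affine_def by (simp add: bij_comp algebra_simps)

lemma word_map_simps [simp]:
  "word_map S [] = id" "word_map S (i # w) = S i \<circ> word_map S w"
  by (simp_all add: word_map_def)

lemma word_map_monomial_affine:
  assumes "sponge_ifs I S" and "w \<in> lists I"
  shows "\<exists>\<tau> c t. monomial_affine (word_map S w) \<tau> c t"
  using assms(2)
proof (induction w rule: lists.induct)
  case Nil
  show ?case using monomial_affine_id by (simp only: word_map_simps) blast
next
  case (Cons i w)
  then have "affine_map (S i)" "generalised_permutation_matrix (linear_part (S i))"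
    using assms(1) by (auto simp: sponge_ifs_def)
  then obtain \<tau> c t where "monomial_affine (S i) \<tau> c t"
    by (rule monomial_affine_of_generalised_permutation)
  with Cons.IH show ?case
    unfolding word_map_simps using monomial_affine_comp by blast
qed

lemma word_map_unit_cube:
  assumes "sponge_ifs I S" and "w \<in> lists I"
  shows "word_map S w ` unit_cube \<subseteq> unit_cube"
  using assms(2)
proof (induction w rule: lists.induct)
  case (Cons i w)
  then have "S i ` unit_cube \<subseteq> unit_cube"
    using assms(1) by (simp add: sponge_ifs_def)
  with Cons.IH show ?case by (auto simp: image_subset_iff)
qed simp

lemma word_map_attractor:
  assumes "is_attractor I S F" and "w \<in> lists I"
  shows "word_map S w ` F \<subseteq> F"
  using assms(2)
proof (induction w rule: lists.induct)
  case (Cons i w)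
  then have "S i ` F \<subseteq> F"
    using assms(1) unfolding is_attractor_def by blast
  with Cons.IH show ?case by (auto simp: image_subset_iff)
qed simp

lemma sum_Basis_nth: "(\<Sum>b\<in>Basis. b $ i) = (1::real)" for i :: "'n::finite"
proof -
  have "(axis i 1 :: real^'n) \<in> Basis" by (simp add: axis_in_Basis_iff)
  then have "(One :: real^'n) \<bullet> axis i 1 = 1"
    using inner_sum_left_Basis[of "axis i 1 :: real^'n" "\<lambda>_. 1"] by simp
  then show ?thesis by (simp add: inner_axis)
qed

lemma mem_unit_cube: "x \<in> unit_cube \<longleftrightarrow> (\<forall>i. 0 \<le> x $ i \<and> x $ i \<le> 1)"
  by (simp add: mem_box_cart sum_Basis_nth)

lemma monomial_affine_le_1:
  fixes f :: "real^3 \<Rightarrow> real^3"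
  assumes "monomial_affine f \<tau> c t" and "f ` unit_cube \<subseteq> unit_cube"
  shows "\<bar>c i\<bar> \<le> 1"
proof -
  have "0 \<in> unit_cube" "One \<in> unit_cube"
    by (simp_all add: mem_unit_cube sum_Basis_nth)
  then have "f 0 \<in> unit_cube" "f One \<in> unit_cube"
    using assms(2) by blast+
  then have "0 \<le> f 0 $ i" "f 0 $ i \<le> 1" "0 \<le> f One $ i" "f One $ i \<le> 1"
    by (simp_all only: mem_unit_cube)
  moreover have "f One $ i - f 0 $ i = c i"
    using assms(1) by (simp add: monomial_affine_def sum_Basis_nth)
  ultimately show ?thesis by linarith
qed

lemma edge_length_monomial_affine:
  fixes f :: "real^3 \<Rightarrow> real^3"
  assumes "monomial_affine f \<tau> c t"
  shows "edge_length (f ` unit_cube) i = \<bar>c i\<bar>"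
proof -
  have "(\<lambda>x. x $ \<tau> i) ` unit_cube = {0..1}"
  proof
    show "{0..1} \<subseteq> (\<lambda>x. x $ \<tau> i) ` unit_cube"
    proof
      fix y :: real assume "y \<in> {0..1}"
      then show "y \<in> (\<lambda>x. x $ \<tau> i) ` unit_cube"
        by (intro image_eqI[of _ _ "\<chi> j. y"]) (auto simp: mem_unit_cube)
    qed
  qed (auto simp: mem_unit_cube)
  then have "(\<lambda>y. c i * y + t $ i) ` {0..1} = (\<lambda>x. c i * x $ \<tau> i + t $ i) ` unit_cube"
    by (simp only: image_image flip: \<open>(\<lambda>x. x $ \<tau> i) ` unit_cube = {0..1}\<close>)
  also have "\<dots> = (\<lambda>x. x $ i) ` f ` unit_cube"
    using assms unfolding image_image by (intro image_cong refl) (simp add: monomial_affine_def)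
  finally have "(\<lambda>x. x $ i) ` f ` unit_cube = (\<lambda>y. c i * y + t $ i) ` {0..1}" ..
  then show ?thesis
    by (auto simp: edge_length_def image_affinity_atLeastAtMost)
qed

lemma linear_part_monomial_affine:
  fixes f :: "real^'n \<Rightarrow> real^'n"
  assumes "monomial_affine f \<tau> c t"
  shows "linear_part f $ i $ j = (if j = \<tau> i then c i else 0)"
  using assms by (simp add: monomial_affine_def linear_part_def matrix_def axis_def)

text \<open>
  The Gram matrix is diagonal, and its entry at \<open>\<tau> i\<close> is \<open>(c i)\<^sup>2\<close>.
\<close>

lemma det_gram_monomial_affine:
  fixes f :: "real^'n \<Rightarrow> real^'n"
  assumes "monomial_affine f \<tau> c t"
  shows "det (mat x - transpose (linear_part f) ** linear_part f) = (\<Prod>i\<in>UNIV. x - (c i)\<^sup>2)"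
proof -
  have bij: "bij \<tau>" using assms by (simp add: monomial_affine_def)
  have gram: "(transpose (linear_part f) ** linear_part f) $ j $ k
      = (if j = k then (c (inv \<tau> j))\<^sup>2 else 0)" for j k
  proof -
    have "(transpose (linear_part f) ** linear_part f) $ j $ k
        = (\<Sum>i\<in>UNIV. if i = inv \<tau> j then (if j = k then (c i)\<^sup>2 else 0) else 0)"
      unfolding matrix_matrix_mult_def transpose_def
      by (auto simp: linear_part_monomial_affine[OF assms] power2_eq_square bij_inv_eq_iff[OF bij]
          intro!: sum.cong)
    then show ?thesis by simp
  qed
  have "det (mat x - transpose (linear_part f) ** linear_part f)
      = (\<Prod>j\<in>UNIV. x - (c (inv \<tau> j))\<^sup>2)"
    by (subst det_diagonal) (simp_all add: gram mat_def)
  also have "\<dots> = (\<Prod>i\<in>UNIV. x - (c i)\<^sup>2)"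
    using prod.reindex_bij_betw[OF bij_imp_bij_inv[OF bij], of "\<lambda>i. x - (c i)\<^sup>2"] by simp
  finally show ?thesis .
qed

lemma alpha_monomial_affine:
  assumes "monomial_affine (word_map S w) \<tau> c t"
    and "UNIV = {i1, i2, i3}" and "distinct [i1, i2, i3]"
    and "\<bar>c i2\<bar> \<le> \<bar>c i1\<bar>" and "\<bar>c i3\<bar> \<le> \<bar>c i2\<bar>"
  shows "alpha S 1 w = \<bar>c i1\<bar>" "alpha S 2 w = \<bar>c i2\<bar>" "alpha S 3 w = \<bar>c i3\<bar>"
proof -
  have "(\<Prod>i\<in>UNIV. x - (c i)\<^sup>2) = (x - (c i1)\<^sup>2) * ((x - (c i2)\<^sup>2) * (x - (c i3)\<^sup>2))" for x
    by (subst assms(2)) (use assms(3) in simp)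
  then have "is_singular_values (linear_part (word_map S w)) [\<bar>c i1\<bar>, \<bar>c i2\<bar>, \<bar>c i3\<bar>]"
    using assms(4,5) unfolding is_singular_values_def det_gram_monomial_affine[OF assms(1)]
    by simp
  then have "singular_values (linear_part (word_map S w)) = [\<bar>c i1\<bar>, \<bar>c i2\<bar>, \<bar>c i3\<bar>]"
    by (rule singular_values_eqI)
  then show "alpha S 1 w = \<bar>c i1\<bar>" "alpha S 2 w = \<bar>c i2\<bar>" "alpha S 3 w = \<bar>c i3\<bar>"
    by (simp_all add: alpha_def)
qed

section \<open>Covering an image through two projections\<close>

lemma axis_proj_nth: "axis_proj j x $ k = (if k = j then x $ j else 0)"
  by (simp add: axis_proj_def axis_def)

lemma plane_proj_nth: "plane_proj j x $ k = (if k = j then 0 else x $ k)"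
  by (simp add: plane_proj_def axis_def)

lemma dist_axis_proj: "dist (axis_proj j x) (axis_proj j y) = \<bar>x $ j - y $ j\<bar>"
proof -
  have "axis_proj j x - axis_proj j y = axis j (x $ j - y $ j)"
    by (simp add: vec_eq_iff axis_proj_def axis_def)
  then show ?thesis by (simp add: dist_norm norm_eq_sqrt_inner[of "axis j _"] inner_axis_axis)
qed

lemma bounded_axis_proj:
  assumes "bounded F"
  shows "bounded (axis_proj j ` F)"
proof -
  obtain L where L: "\<And>x. x \<in> F \<Longrightarrow> norm x \<le> L"
    using assms by (auto simp: bounded_iff)
  have "axis_proj j 0 = 0" by (simp add: vec_eq_iff axis_proj_nth)
  then have "norm (axis_proj j x) = \<bar>x $ j\<bar>" for x
    using dist_axis_proj[of j x 0] by simp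
  then have "norm (axis_proj j x) \<le> L" if "x \<in> F" for x
    using component_le_norm_cart[of x j] L[OF that] by simp
  then show ?thesis by (auto simp: bounded_iff)
qed

lemma bounded_plane_proj: "bounded F \<Longrightarrow> bounded (plane_proj j ` F)"
proof -
  assume F: "bounded F"
  have "plane_proj j ` F \<subseteq> (\<lambda>(x, y). x - y) ` (F \<times> axis_proj j ` F)"
    by (auto simp: plane_proj_def axis_proj_def)
  then show ?thesis
    using bounded_minus_comp bounded_subset bounded_minus[OF F bounded_axis_proj[OF F]] by blast
qed

text \<open>
  The image of \<open>F\<close> lies in \<open>F\<close>, so the projection to axis \<open>i\<close> contains a copy of the projection to axis
  \<open>\<tau> i\<close>, scaled by \<open>\<bar>c i\<bar>\<close>.
\<close>

lemma covering_number_axis_proj_le: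
  fixes f :: "real^3 \<Rightarrow> real^3"
  assumes f: "monomial_affine f \<tau> c t" and "f ` F \<subseteq> F" and "0 < r" and "x \<in> F"
  shows "covering_number r (ball (axis_proj (\<tau> i) x) \<rho> \<inter> axis_proj (\<tau> i) ` F)
    \<le> covering_number (\<bar>c i\<bar> * r) (ball (axis_proj i (f x)) (\<bar>c i\<bar> * \<rho>) \<inter> axis_proj i ` F)"
    (is "covering_number r ?E \<le> covering_number _ ?E'")
proof (rule covering_number_le_image[where g = "\<lambda>y. axis i (c i * y $ \<tau> i + t $ i)"])
  have c: "0 < \<bar>c i\<bar>" and fi: "f z $ i = c i * z $ \<tau> i + t $ i" for z
    using f by (auto simp: monomial_affine_def)
  show "bounded ?E'" by (intro bounded_Int) auto
  show "0 < \<bar>c i\<bar> * r" using c \<open>0 < r\<close> by simp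
  show "(\<lambda>y. axis i (c i * y $ \<tau> i + t $ i)) ` ?E \<subseteq> ?E'"
  proof clarify
    fix z assume z: "z \<in> F" "axis_proj (\<tau> i) z \<in> ball (axis_proj (\<tau> i) x) \<rho>"
    have "axis i (c i * axis_proj (\<tau> i) z $ \<tau> i + t $ i) = axis_proj i (f z)"
      by (simp add: axis_proj_def fi)
    moreover have "\<bar>f x $ i - f z $ i\<bar> = \<bar>c i\<bar> * \<bar>x $ \<tau> i - z $ \<tau> i\<bar>"
      by (simp add: fi abs_mult[symmetric] algebra_simps)
    then have "axis_proj i (f z) \<in> ball (axis_proj i (f x)) (\<bar>c i\<bar> * \<rho>)"
      using z c by (simp add: dist_axis_proj)
    ultimately show "axis i (c i * axis_proj (\<tau> i) z $ \<tau> i + t $ i) \<in> ?E'"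
      using z(1) assms(2) by auto
  qed
  show "box_close r y z" if "y \<in> ?E" "z \<in> ?E"
    and close: "box_close (\<bar>c i\<bar> * r) (axis i (c i * y $ \<tau> i + t $ i)) (axis i (c i * z $ \<tau> i + t $ i))" for y z
    unfolding box_close_cart
  proof
    fix k
    have "\<bar>c i\<bar> * \<bar>y $ \<tau> i - z $ \<tau> i\<bar> \<le> \<bar>c i\<bar> * r"
      using close[unfolded box_close_cart, rule_format, of i]
      by (simp add: abs_mult[symmetric] algebra_simps)
    then have "\<bar>y $ \<tau> i - z $ \<tau> i\<bar> \<le> r" using c by simp
    then show "\<bar>y $ k - z $ k\<bar> \<le> r"
      using that(1,2) \<open>0 < r\<close> by (cases "k = \<tau> i") (auto simp: axis_proj_nth)
  qed
qed

text \<open>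
  The same for planes. The two remaining coordinates are scaled by different factors, so the copy
  is only bi-Lipschitz, and \<open>\<kappa>\<close> bounds the contraction.
\<close>

lemma covering_number_plane_proj_le:
  fixes f :: "real^3 \<Rightarrow> real^3"
  assumes f: "monomial_affine f \<tau> c t" and "f ` F \<subseteq> F" and "bounded F" and "0 < r"
    and "0 < \<kappa>" and \<kappa>: "\<And>k. \<kappa> \<le> \<bar>c k\<bar>"
  shows "covering_number r (plane_proj (\<tau> i) ` F) \<le> covering_number (\<kappa> * r) (plane_proj i ` F)"
proof (rule covering_number_le_image[where g = "\<lambda>y. plane_proj i (f y)"])
  have \<tau>: "bij \<tau>" and f_nth: "f z $ k = c k * z $ \<tau> k + t $ k" for z k
    using f by (auto simp: monomial_affine_def)
  show "bounded (plane_proj i ` F)" using \<open>bounded F\<close> by (rule bounded_plane_proj)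
  show "0 < \<kappa> * r" using assms by simp
  have "plane_proj i (f (plane_proj (\<tau> i) z)) = plane_proj i (f z)" for z
    using bij_is_inj[OF \<tau>] by (auto simp: vec_eq_iff plane_proj_nth f_nth dest: injD)
  then show "(\<lambda>y. plane_proj i (f y)) ` plane_proj (\<tau> i) ` F \<subseteq> plane_proj i ` F"
    using assms(2) by auto
  show "box_close r y z" if "y \<in> plane_proj (\<tau> i) ` F" "z \<in> plane_proj (\<tau> i) ` F"
    and close: "box_close (\<kappa> * r) (plane_proj i (f y)) (plane_proj i (f z))" for y z
    unfolding box_close_cart
  proof
    fix k
    obtain l where l: "k = \<tau> l" using \<tau> by (metis bij_pointE)
    show "\<bar>y $ k - z $ k\<bar> \<le> r"
    proof (cases "l = i")
      case True
      then show ?thesis using that(1,2) l \<open>0 < r\<close> by (auto simp: plane_proj_nth)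
    next
      case False
      then have "\<bar>c l\<bar> * \<bar>y $ k - z $ k\<bar> \<le> \<kappa> * r"
        using close[unfolded box_close_cart, rule_format, of l]
        by (simp add: plane_proj_nth f_nth l abs_mult[symmetric] algebra_simps)
      also have "\<dots> \<le> \<bar>c l\<bar> * r" using \<kappa> \<open>0 < r\<close> by (intro mult_right_mono) auto
      finally have "\<bar>c l\<bar> * \<bar>y $ k - z $ k\<bar> \<le> \<bar>c l\<bar> * r" .
      moreover have "0 < \<bar>c l\<bar>" using \<open>0 < \<kappa>\<close> \<kappa>[of l] by simp
      ultimately show ?thesis by simp
    qed
  qed
qed

text \<open>
  The count of the proof. A point of \<open>F\<close> gets a label with three components: a square of side
  \<open>\<rho> / \<bar>c i2\<bar>\<close> that contains its projection along direction \<open>\<tau> i3\<close>; an interval of length \<open>\<rho> / \<bar>c i1\<bar>\<close>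
  that contains its coordinate \<open>\<tau> i1\<close>, out of at most \<open>N\<close> intervals that may depend on the square; and
  an interval of length \<open>1 / 4\<close> for its coordinate \<open>\<tau> i3\<close>. Two points with the same label have images
  that differ by at most \<open>\<rho>\<close> in every coordinate.
\<close>

lemma covering_number_monomial_affine_le:
  fixes f :: "real^3 \<Rightarrow> real^3"
  assumes f: "monomial_affine f \<tau> c t"
    and UNIV: "UNIV = {i1, i2, i3}" and dist: "distinct [i1, i2, i3]"
    and "bounded F" and "F \<noteq> {}" and L: "\<And>x j. x \<in> F \<Longrightarrow> \<bar>x $ j\<bar> \<le> L"
    and "0 < \<rho>" and "\<bar>c i3\<bar> \<le> 4 * \<rho>"
    and N: "\<And>x. x \<in> F \<Longrightarrow> real (covering_number (\<rho> / \<bar>c i1\<bar>)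
      (ball (axis_proj (\<tau> i1) x) (2 * (\<rho> / \<bar>c i2\<bar>)) \<inter> axis_proj (\<tau> i1) ` F)) \<le> N"
  shows "real (covering_number \<rho> (f ` F))
    \<le> real (covering_number (\<rho> / \<bar>c i2\<bar>) (plane_proj (\<tau> i3) ` F)) * (N * real (card {0..\<lfloor>8 * L\<rfloor>}))"
proof -
  define r R where "r = \<rho> / \<bar>c i1\<bar>" and "R = \<rho> / \<bar>c i2\<bar>"
  define j1 j2 j3 where "j1 = \<tau> i1" and "j2 = \<tau> i2" and "j3 = \<tau> i3"
  have c: "0 < \<bar>c i\<bar>" and f_nth: "f z $ i = c i * z $ \<tau> i + t $ i" for z i
    using f by (auto simp: monomial_affine_def)
  have pos: "0 < r" "0 < R" using c \<open>0 < \<rho>\<close> by (auto simp: r_def R_def)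
  have j: "j1 \<noteq> j3" "j2 \<noteq> j3"
    using f dist unfolding j1_def j2_def j3_def monomial_affine_def by (auto dest: bij_is_inj injD)
  obtain A :: "(real^3) set" and l where A: "finite A"
      "card A = covering_number R (plane_proj j3 ` F)" "l ` plane_proj j3 ` F \<subseteq> A"
      "\<And>x y. x \<in> plane_proj j3 ` F \<Longrightarrow> y \<in> plane_proj j3 ` F \<Longrightarrow> l x = l y \<Longrightarrow> box_close R x y"
    by (rule covering_number_labels[OF bounded_plane_proj[OF \<open>bounded F\<close>] \<open>0 < R\<close>]) blast
  define E where "E x = ball (axis_proj j1 x) (2 * R) \<inter> axis_proj j1 ` F" for x
  define Q :: "real^3 \<Rightarrow> (real^3) set \<Rightarrow> (real^3 \<Rightarrow> real^3) \<Rightarrow> bool" where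
    "Q x B m \<longleftrightarrow> finite B \<and> real (card B) \<le> N \<and> m ` E x \<subseteq> B \<and>
       (\<forall>y\<in>E x. \<forall>z\<in>E x. m y = m z \<longrightarrow> box_close r y z)" for x B m
  have "\<exists>B m. Q x B m" if x: "x \<in> F" for x
  proof -
    have "bounded (E x)" unfolding E_def by (intro bounded_Int) auto
    then obtain B :: "(real^3) set" and m where "finite B" "card B = covering_number r (E x)" "m ` E x \<subseteq> B"
        "\<And>y z. y \<in> E x \<Longrightarrow> z \<in> E x \<Longrightarrow> m y = m z \<Longrightarrow> box_close r y z"
      by (rule covering_number_labels[OF _ \<open>0 < r\<close>]) blast
    then have "Q x B m"
      using N[OF x] by (auto simp: Q_def E_def r_def R_def j1_def)
    then show ?thesis by blast
  qed
  then obtain B m where Bm: "\<And>x. x \<in> F \<Longrightarrow> Q x (B x) (m x)" by metis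
  define cell where "cell x = l (plane_proj j3 x)" for x
  \<comment> \<open>A point of \<open>F\<close> over each square, as centre of the ball that contains what lies over that square.\<close>
  define rep where "rep a = (SOME x. x \<in> F \<and> cell x = a)" for a
  have rep: "rep (cell x) \<in> F" "cell (rep (cell x)) = cell x" if "x \<in> F" for x
    using someI[of "\<lambda>y. y \<in> F \<and> cell y = cell x" x] that by (auto simp: rep_def)
  have same_cell: "\<bar>x $ k - y $ k\<bar> \<le> R" if "x \<in> F" "y \<in> F" "cell x = cell y" "k \<noteq> j3" for x y k
    using A(4)[of "plane_proj j3 x" "plane_proj j3 y"] that
    by (auto simp: cell_def box_close_cart plane_proj_nth split: if_splits dest!: spec[of _ k])
  have in_E: "axis_proj j1 x \<in> E (rep (cell x))" if x: "x \<in> F" for x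
    using same_cell[OF rep(1)[OF x] x rep(2)[OF x] j(1)] x pos by (auto simp: E_def dist_axis_proj)
  \<comment> \<open>Coordinates of points of \<open>F\<close> lie in an interval of length \<open>2 L\<close>, that is, \<open>8 L\<close> quarters.\<close>
  define label where
    "label x = (cell x, m (rep (cell x)) (axis_proj j1 x), \<lfloor>4 * (x $ j3 + L)\<rfloor>)" for x
  define J where "J = Sigma (cell ` F) (\<lambda>a. B (rep a) \<times> {0..\<lfloor>8 * L\<rfloor>})"
  have cells: "cell ` F \<subseteq> A" using A(3) by (auto simp: cell_def)
  have fin_cells: "finite (cell ` F)" using cells A(1) by (rule finite_subset)
  have B: "finite (B (rep a))" "real (card (B (rep a))) \<le> N" if "a \<in> cell ` F" for a
    using that Bm rep unfolding Q_def by auto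
  have "covering_number \<rho> (f ` F) \<le> card J"
  proof (rule covering_number_le_card)
    show "finite J" unfolding J_def using B fin_cells by (intro finite_SigmaI) auto
    show "label ` F \<subseteq> J"
    proof (rule image_subsetI)
      fix x assume x: "x \<in> F"
      have "m (rep (cell x)) (axis_proj j1 x) \<in> B (rep (cell x))"
        using Bm[OF rep(1)[OF x]] in_E[OF x] unfolding Q_def by blast
      moreover have "\<lfloor>4 * (x $ j3 + L)\<rfloor> \<in> {0..\<lfloor>8 * L\<rfloor>}"
        using L[OF x, of j3] by (auto intro!: floor_mono)
      ultimately show "label x \<in> J" using x by (simp add: label_def J_def)
    qed
    show "box_close \<rho> (f x) (f y)" if xy: "x \<in> F" "y \<in> F" "label x = label y" for x y
      unfolding box_close_cart
    proof
      have eq: "cell x = cell y" "\<lfloor>4 * (x $ j3 + L)\<rfloor> = \<lfloor>4 * (y $ j3 + L)\<rfloor>"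
        "m (rep (cell x)) (axis_proj j1 x) = m (rep (cell x)) (axis_proj j1 y)"
        using xy(3) by (auto simp: label_def)
      fix i
      have diff: "\<bar>f x $ k - f y $ k\<bar> = \<bar>c k\<bar> * \<bar>x $ \<tau> k - y $ \<tau> k\<bar>" for k
        by (simp add: f_nth abs_mult[symmetric] algebra_simps)
      have "i \<in> {i1, i2, i3}" using UNIV by blast
      then consider "i = i1" | "i = i2" | "i = i3" by blast
      then show "\<bar>f x $ i - f y $ i\<bar> \<le> \<rho>"
      proof cases
        case 1
        have "box_close r (axis_proj j1 x) (axis_proj j1 y)"
          using Bm[OF rep(1)[OF xy(1)]] in_E[OF xy(1)] in_E[OF xy(2)] eq unfolding Q_def by simp
        then have "\<bar>x $ j1 - y $ j1\<bar> \<le> r"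
          by (auto simp: box_close_cart axis_proj_nth split: if_splits)
        then show ?thesis
          unfolding 1 diff using c[of i1] by (simp add: r_def j1_def field_simps)
      next
        case 2
        have "\<bar>x $ j2 - y $ j2\<bar> \<le> R" using same_cell xy eq j by blast
        then show ?thesis
          unfolding 2 diff using c[of i2] by (simp add: R_def j2_def field_simps)
      next
        case 3
        have "\<bar>u - v\<bar> \<le> 1" if "\<lfloor>u\<rfloor> = \<lfloor>v\<rfloor>" for u v :: real
          using that by linarith
        from this[OF eq(2)] have "x $ j3 - y $ j3 \<le> 1 / 4" "y $ j3 - x $ j3 \<le> 1 / 4"
          by (simp_all add: abs_le_iff algebra_simps)
        then have "\<bar>x $ j3 - y $ j3\<bar> \<le> 1 / 4" by (intro abs_leI) simp_all
        then have "\<bar>c i3\<bar> * \<bar>x $ j3 - y $ j3\<bar> \<le> (4 * \<rho>) * (1 / 4)"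
          using \<open>\<bar>c i3\<bar> \<le> 4 * \<rho>\<close> \<open>0 < \<rho>\<close> by (intro mult_mono) auto
        then show ?thesis unfolding 3 diff j3_def by simp
      qed
    qed
  qed
  then have "real (covering_number \<rho> (f ` F)) \<le> real (card J)" by simp
  also have "\<dots> = (\<Sum>a\<in>cell ` F. real (card (B (rep a))) * real (card {0..\<lfloor>8 * L\<rfloor>}))"
    unfolding J_def using B fin_cells by (subst card_SigmaI) (auto simp: card_cartesian_product)
  also have "\<dots> \<le> (\<Sum>a\<in>cell ` F. N * real (card {0..\<lfloor>8 * L\<rfloor>}))"
    using B by (intro sum_mono mult_right_mono) auto
  also have "\<dots> = real (card (cell ` F)) * (N * real (card {0..\<lfloor>8 * L\<rfloor>}))" by simp
  also have "\<dots> \<le> real (card A) * (N * real (card {0..\<lfloor>8 * L\<rfloor>}))"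
  proof -
    obtain x where "x \<in> F" using \<open>F \<noteq> {}\<close> by blast
    then have "0 \<le> N" using N[of x] by simp
    then show ?thesis using card_mono[OF A(1) cells] by (intro mult_right_mono) auto
  qed
  finally show ?thesis by (simp add: A(2) R_def j3_def)
qed

section \<open>Constants that do not depend on the word\<close>

lemma uniform_constant:
  fixes P :: "'a::finite \<Rightarrow> 'b::finite \<Rightarrow> real \<Rightarrow> bool"
  assumes "\<And>i j. \<exists>C>0. P i j C" and mono: "\<And>i j C D. P i j C \<Longrightarrow> C \<le> D \<Longrightarrow> P i j D"
  shows "\<exists>C>0. \<forall>i j. P i j C"
proof -
  obtain C where C: "\<And>i j. 0 < C i j \<and> P i j (C i j)" using assms(1) by metis
  define K where "K = (\<Sum>i\<in>UNIV. \<Sum>j\<in>UNIV. C i j)"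
  have "C i j \<le> K" for i j
  proof -
    have "C i j \<le> (\<Sum>j\<in>UNIV. C i j)"
      using C by (intro member_le_sum) (auto intro: less_imp_le)
    also have "\<dots> \<le> K"
      unfolding K_def using C
      by (intro member_le_sum[where f = "\<lambda>i. \<Sum>j\<in>UNIV. C i j"] sum_nonneg) (auto intro: less_imp_le)
    finally show ?thesis .
  qed
  then have "P i j K" for i j using C mono by blast
  moreover have "0 < K" using C[of undefined undefined] \<open>C undefined undefined \<le> K\<close> by linarith
  ultimately show ?thesis by blast
qed

text \<open>
  The conclusion for a word depends on the word only through the pair \<open>(i, \<tau> i)\<close>. For each pair that
  occurs, the bound is transported along one fixed word \<open>u\<close>, and the finitely many constants are
  combined. The ratio \<open>R / r\<close> does not change under this transport, so the exponent may be the
  dimension of the projection to axis \<open>i\<close> although the set lies on axis \<open>\<tau> i\<close>.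
\<close>

lemma axis_proj_covering_bound:
  assumes IFS: "sponge_ifs I S" and F: "is_attractor I S F" and "0 < \<eta>"
  shows "\<exists>C>0. \<forall>u\<in>lists I. \<forall>\<tau> c t i. monomial_affine (word_map S u) \<tau> c t \<longrightarrow>
    (\<forall>r R. \<forall>x\<in>F. 0 < r \<and> r \<le> R \<and> R \<le> 1 / 4 \<longrightarrow>
      real (covering_number r (ball (axis_proj (\<tau> i) x) (2 * R) \<inter> axis_proj (\<tau> i) ` F))
        \<le> C * (R / r) powr real_of_ereal (quasi_Assouad_dim (axis_proj i ` F)) * r powr - \<eta>)"
proof -
  define s where "s i = real_of_ereal (quasi_Assouad_dim (axis_proj i ` F))" for i
  define P where "P i j C \<longleftrightarrow> (\<forall>r R. \<forall>x\<in>F. 0 < r \<and> r \<le> R \<and> R \<le> 1 / 4 \<longrightarrow>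
      real (covering_number r (ball (axis_proj j x) (2 * R) \<inter> axis_proj j ` F))
        \<le> C * (R / r) powr s i * r powr - \<eta>)" for i j C
  define T where "T i j \<longleftrightarrow> (\<exists>u\<in>lists I. \<exists>\<tau> c t. monomial_affine (word_map S u) \<tau> c t \<and> \<tau> i = j)" for i j
  have "\<exists>C>0. T i j \<longrightarrow> P i j C" for i j
  proof (cases "T i j")
    case True
    then obtain u \<tau> c t where u: "u \<in> lists I" and f: "monomial_affine (word_map S u) \<tau> c t"
      and j: "\<tau> i = j" unfolding T_def by blast
    define a where "a = \<bar>c i\<bar>"
    have a: "0 < a" "a \<le> 1"
      using f monomial_affine_le_1[OF f word_map_unit_cube[OF IFS u]]
      by (auto simp: a_def monomial_affine_def)
    have "axis_proj i ` F \<noteq> {}" using F by (auto simp: is_attractor_def)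
    from covering_number_le_quasi_Assouad_dim[OF this \<open>0 < \<eta>\<close>]
    obtain C where C: "0 < C" "\<And>r R y. y \<in> axis_proj i ` F \<Longrightarrow> 0 < r \<Longrightarrow> r \<le> R \<Longrightarrow> R \<le> 1 / 4 \<Longrightarrow>
        real (covering_number r (ball y (2 * R) \<inter> axis_proj i ` F)) \<le> C * (R / r) powr s i * r powr - \<eta>"
      unfolding s_def by metis
    have "P i j (C * a powr - \<eta>)"
      unfolding P_def
    proof (intro allI ballI impI, elim conjE)
      fix r R x assume x: "x \<in> F" and r: "0 < r" "r \<le> R" "R \<le> 1 / (4::real)"
      have fx: "word_map S u x \<in> F" using word_map_attractor[OF F u] x by blast
      have "real (covering_number r (ball (axis_proj j x) (2 * R) \<inter> axis_proj j ` F))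
          \<le> real (covering_number (a * r) (ball (axis_proj i (word_map S u x)) (a * (2 * R)) \<inter> axis_proj i ` F))"
        unfolding j[symmetric] a_def of_nat_le_iff
        by (rule covering_number_axis_proj_le[OF f word_map_attractor[OF F u] \<open>0 < r\<close> x])
      also have "a * (2 * R) = 2 * (a * R)" by simp
      also have "real (covering_number (a * r) (ball (axis_proj i (word_map S u x)) (2 * (a * R)) \<inter> axis_proj i ` F))
          \<le> C * ((a * R) / (a * r)) powr s i * (a * r) powr - \<eta>"
        using fx r a mult_mono[of a 1 R "1 / 4"] by (intro C(2)) auto
      also have "\<dots> = C * a powr - \<eta> * (R / r) powr s i * r powr - \<eta>"
        using a r by (simp add: powr_mult mult_ac)
      finally show "real (covering_number r (ball (axis_proj j x) (2 * R) \<inter> axis_proj j ` F))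
          \<le> C * a powr - \<eta> * (R / r) powr s i * r powr - \<eta>" .
    qed
    with C(1) a show ?thesis by (intro exI[of _ "C * a powr - \<eta>"]) auto
  qed (auto intro: exI[of _ 1])
  moreover have "T i j \<longrightarrow> P i j D" if "T i j \<longrightarrow> P i j C" "C \<le> D" for i j C D
    unfolding P_def
  proof (intro allI ballI impI, elim conjE)
    fix r R x assume "T i j" and x: "x \<in> F" and r: "0 < r" "r \<le> R" "R \<le> 1 / (4::real)"
    then have "real (covering_number r (ball (axis_proj j x) (2 * R) \<inter> axis_proj j ` F))
        \<le> C * (R / r) powr s i * r powr - \<eta>"
      using that(1) unfolding P_def by blast
    also have "\<dots> \<le> D * (R / r) powr s i * r powr - \<eta>"
      using that(2) by (intro mult_right_mono) auto
    finally show "real (covering_number r (ball (axis_proj j x) (2 * R) \<inter> axis_proj j ` F))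
        \<le> D * (R / r) powr s i * r powr - \<eta>" .
  qed
  ultimately have "\<exists>C>0. \<forall>i j. T i j \<longrightarrow> P i j C"
    by (rule uniform_constant)
  then obtain C where "0 < C" and C: "\<And>i j. T i j \<Longrightarrow> P i j C" by blast
  have "P i (\<tau> i) C" if "u \<in> lists I" "monomial_affine (word_map S u) \<tau> c t" for u \<tau> c t i
    using that by (intro C) (auto simp: T_def)
  then have "\<forall>u\<in>lists I. \<forall>\<tau> c t i. monomial_affine (word_map S u) \<tau> c t \<longrightarrow> P i (\<tau> i) C"
    by blast
  with \<open>0 < C\<close> show ?thesis unfolding P_def s_def by (intro exI[of _ C] conjI)
qed

text \<open>
  The argument of \<open>axis_proj_covering_bound\<close>, with the upper box dimension. The side \<open>q / 4\<close> is the
  scale at which the bound is applied, with \<open>q = \<alpha>\<^sub>3 / \<alpha>\<^sub>2\<close>; stating the right-hand side in terms of \<open>q\<close>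
  puts the power of \<open>4\<close>, which depends on \<open>i\<close>, into the constant.
\<close>

lemma plane_proj_covering_bound:
  assumes IFS: "sponge_ifs I S" and F: "is_attractor I S F" and "0 < \<eta>"
  shows "\<exists>C>0. \<forall>u\<in>lists I. \<forall>\<tau> c t i. monomial_affine (word_map S u) \<tau> c t \<longrightarrow>
    (\<forall>q. 0 < q \<and> q \<le> 1 \<longrightarrow> real (covering_number (q / 4) (plane_proj (\<tau> i) ` F))
        \<le> C * q powr - (real_of_ereal (upper_box_dim (plane_proj i ` F)) + \<eta>))"
proof -
  define s where "s i = real_of_ereal (upper_box_dim (plane_proj i ` F))" for i
  define P where "P i j C \<longleftrightarrow> (\<forall>q. 0 < q \<and> q \<le> 1 \<longrightarrow>
      real (covering_number (q / 4) (plane_proj j ` F)) \<le> C * q powr - (s i + \<eta>))" for i j C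
  define T where "T i j \<longleftrightarrow> (\<exists>u\<in>lists I. \<exists>\<tau> c t. monomial_affine (word_map S u) \<tau> c t \<and> \<tau> i = j)" for i j
  have bounded: "bounded F" using F by (auto simp: is_attractor_def compact_imp_bounded)
  have "\<exists>C>0. T i j \<longrightarrow> P i j C" for i j
  proof (cases "T i j")
    case True
    then obtain u \<tau> c t where u: "u \<in> lists I" and f: "monomial_affine (word_map S u) \<tau> c t"
      and j: "\<tau> i = j" unfolding T_def by blast
    define \<kappa> where "\<kappa> = Min (range (\<lambda>k. \<bar>c k\<bar>))"
    have \<kappa>: "0 < \<kappa>" "\<kappa> \<le> \<bar>c k\<bar>" for k
      using f by (auto simp: \<kappa>_def monomial_affine_def)
    have "\<kappa> \<le> 1"
      using \<kappa>(2) monomial_affine_le_1[OF f word_map_unit_cube[OF IFS u]] by (meson order_trans)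
    have "plane_proj i ` F \<noteq> {}" using F by (auto simp: is_attractor_def)
    from covering_number_le_upper_box_dim[OF bounded_plane_proj[OF bounded] this \<open>0 < \<eta>\<close>]
    obtain C where C: "0 < C" "\<And>q. 0 < q \<Longrightarrow> q \<le> 1 \<Longrightarrow>
        real (covering_number q (plane_proj i ` F)) \<le> C * q powr - (s i + \<eta>)"
      unfolding s_def by metis
    have "P i j (C * (\<kappa> / 4) powr - (s i + \<eta>))"
      unfolding P_def
    proof (intro allI impI, elim conjE)
      fix q :: real assume q: "0 < q" "q \<le> 1"
      have "real (covering_number (q / 4) (plane_proj j ` F))
          \<le> real (covering_number (\<kappa> * (q / 4)) (plane_proj i ` F))"
        unfolding j[symmetric] of_nat_le_iff using q \<kappa>
        by (intro covering_number_plane_proj_le[OF f word_map_attractor[OF F u] bounded]) auto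
      also have "\<dots> \<le> C * (\<kappa> * (q / 4)) powr - (s i + \<eta>)"
        using q \<kappa> \<open>\<kappa> \<le> 1\<close> mult_mono[of \<kappa> 1 "q / 4" 1] by (intro C(2)) auto
      also have "\<kappa> * (q / 4) = (\<kappa> / 4) * q" by simp
      also have "C * ((\<kappa> / 4) * q) powr - (s i + \<eta>) = C * (\<kappa> / 4) powr - (s i + \<eta>) * q powr - (s i + \<eta>)"
        unfolding powr_mult by simp
      finally show "real (covering_number (q / 4) (plane_proj j ` F))
          \<le> C * (\<kappa> / 4) powr - (s i + \<eta>) * q powr - (s i + \<eta>)" .
    qed
    with C(1) \<kappa>(1) show ?thesis by (intro exI[of _ "C * (\<kappa> / 4) powr - (s i + \<eta>)"]) auto
  qed (auto intro: exI[of _ 1])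
  moreover have "T i j \<longrightarrow> P i j D" if "T i j \<longrightarrow> P i j C" "C \<le> D" for i j C D
    unfolding P_def
  proof (intro allI impI, elim conjE)
    fix q :: real assume "T i j" and q: "0 < q" "q \<le> 1"
    then have "real (covering_number (q / 4) (plane_proj j ` F)) \<le> C * q powr - (s i + \<eta>)"
      using that(1) unfolding P_def by blast
    also have "\<dots> \<le> D * q powr - (s i + \<eta>)"
      using that(2) by (intro mult_right_mono) auto
    finally show "real (covering_number (q / 4) (plane_proj j ` F)) \<le> D * q powr - (s i + \<eta>)" .
  qed
  ultimately have "\<exists>C>0. \<forall>i j. T i j \<longrightarrow> P i j C"
    by (rule uniform_constant)
  then obtain C where "0 < C" and C: "\<And>i j. T i j \<Longrightarrow> P i j C" by blast
  have "P i (\<tau> i) C" if "u \<in> lists I" "monomial_affine (word_map S u) \<tau> c t" for u \<tau> c t i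
    using that by (intro C) (auto simp: T_def)
  then have "\<forall>u\<in>lists I. \<forall>\<tau> c t i. monomial_affine (word_map S u) \<tau> c t \<longrightarrow> P i (\<tau> i) C"
    by blast
  with \<open>0 < C\<close> show ?thesis unfolding P_def s_def by (intro exI[of _ C] conjI)
qed

section \<open>Covering numbers of the images of a sponge\<close>

lemma decreasing_order_of_3:
  fixes g :: "3 \<Rightarrow> real"
  assumes "\<And>k. g i3 \<le> g k"
  obtains i1 i2 where "UNIV = {i1, i2, i3}" "distinct [i1, i2, i3]" "g i2 \<le> g i1" "g i3 \<le> g i2"
proof -
  have "UNIV = {2, 3, 1 :: 3}" "UNIV = {1, 3, 2 :: 3}" "UNIV = {1, 2, 3 :: 3}"
    unfolding UNIV_3 by blast+
  moreover have "distinct [2, 3, 1 :: 3]" "distinct [1, 3, 2 :: 3]" "distinct [1, 2, 3 :: 3]"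
    by simp_all
  ultimately have "\<exists>p q. UNIV = {p, q, i3} \<and> distinct [p, q, i3]"
    using exhaust_3[of i3] by (elim disjE) blast+
  then obtain p q where pq: "UNIV = {p, q, i3}" "distinct [p, q, i3]" by blast
  show thesis
  proof (cases "g q \<le> g p")
    case True
    then show thesis using that[of p q] pq assms by blast
  next
    case False
    then have "g p \<le> g q" by simp
    moreover have "UNIV = {q, p, i3}" using pq(1) by blast
    ultimately show thesis using that[of q p] pq(2) assms by auto
  qed
qed

theorem lemma7p1:
  fixes I :: "'i set" and S :: "'i \<Rightarrow> real^3 \<Rightarrow> real^3" and F :: "(real^3) set" and \<epsilon> :: real
  assumes "sponge_ifs I S" and "is_attractor I S F" and "0 < \<epsilon>" and "\<epsilon> < 1"
  shows "\<exists>K>0. \<forall>a b. longest_choice I S a \<and> shortest_choice I S b \<longrightarrow>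
           (\<forall>\<delta>. 0 < \<delta> \<and> \<delta> < 1 \<longrightarrow> (\<forall>w\<in>stopping I S \<delta>.
              real (covering_number \<delta> (word_map S w ` F))
              \<le> K * (alpha S 1 w / alpha S 2 w) powr p1_bar F a w
                  * (alpha S 2 w / alpha S 3 w) powr p2_bar F b w
                  * alpha S 3 w powr (- \<epsilon>)))"
proof -
  define \<eta> where "\<eta> = \<epsilon> / 2"
  have \<eta>: "0 < \<eta>" using assms by (simp add: \<eta>_def)
  obtain C1 where "0 < C1" and C1: "\<And>u \<tau> c t i r R x. u \<in> lists I \<Longrightarrow> monomial_affine (word_map S u) \<tau> c t \<Longrightarrow>
      x \<in> F \<Longrightarrow> 0 < r \<Longrightarrow> r \<le> R \<Longrightarrow> R \<le> 1 / 4 \<Longrightarrow>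
      real (covering_number r (ball (axis_proj (\<tau> i) x) (2 * R) \<inter> axis_proj (\<tau> i) ` F))
        \<le> C1 * (R / r) powr real_of_ereal (quasi_Assouad_dim (axis_proj i ` F)) * r powr - \<eta>"
    using axis_proj_covering_bound[OF assms(1,2) \<eta>] by metis
  obtain C2 where "0 < C2" and C2: "\<And>u \<tau> c t i q. u \<in> lists I \<Longrightarrow> monomial_affine (word_map S u) \<tau> c t \<Longrightarrow>
      0 < q \<Longrightarrow> q \<le> 1 \<Longrightarrow> real (covering_number (q / 4) (plane_proj (\<tau> i) ` F))
        \<le> C2 * q powr - (real_of_ereal (upper_box_dim (plane_proj i ` F)) + \<eta>)"
    using plane_proj_covering_bound[OF assms(1,2) \<eta>] by metis
  have F: "bounded F" "F \<noteq> {}"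
    using assms(2) by (auto simp: is_attractor_def compact_imp_bounded)
  obtain L where "0 < L" and L: "\<And>x. x \<in> F \<Longrightarrow> norm x \<le> L"
    using F(1) by (auto simp: bounded_pos)
  have L: "\<bar>x $ j\<bar> \<le> L" if "x \<in> F" for x j
    using component_le_norm_cart[of x j] L[OF that] by linarith
  define k where "k = real (card {0..\<lfloor>8 * L\<rfloor>})"
  have "0 \<le> \<lfloor>8 * L\<rfloor>" using \<open>0 < L\<close> by simp
  then have "{0..\<lfloor>8 * L\<rfloor>} \<noteq> {}" by simp
  then have "0 < k"
    unfolding k_def of_nat_0_less_iff card_gt_0_iff by simp
  define K where "K = C2 * (C1 * 4 powr \<eta> * k)"
  have "0 < K" using \<open>0 < C1\<close> \<open>0 < C2\<close> \<open>0 < k\<close> by (simp add: K_def)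
  have "real (covering_number \<delta> (word_map S w ` F))
      \<le> K * (alpha S 1 w / alpha S 2 w) powr p1_bar F a w
          * (alpha S 2 w / alpha S 3 w) powr p2_bar F b w * alpha S 3 w powr (- \<epsilon>)"
    if a: "longest_choice I S a" and b: "shortest_choice I S b" and w: "w \<in> stopping I S \<delta>" for a b \<delta> w
  proof -
    have word: "w \<in> words I" "w \<in> lists I" "alpha S 3 w \<le> \<delta>"
      using w by (auto simp: stopping_def words_def)
    obtain \<tau> c t where f: "monomial_affine (word_map S w) \<tau> c t"
      using word_map_monomial_affine[OF assms(1) word(2)] by blast
    have c: "0 < \<bar>c i\<bar>" "\<bar>c i\<bar> \<le> 1" for i
      using f monomial_affine_le_1[OF f word_map_unit_cube[OF assms(1) word(2)]]
      by (auto simp: monomial_affine_def)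
    have a_max: "\<bar>c j\<bar> \<le> \<bar>c (a w)\<bar>" and b_min: "\<bar>c (b w)\<bar> \<le> \<bar>c j\<bar>" for j
      using a b word(1) edge_length_monomial_affine[OF f]
      by (auto simp: longest_choice_def shortest_choice_def)
    \<comment> \<open>The ordering must end in \<open>b w\<close>, since the planar projection is taken along that direction.\<close>
    obtain i1 i2 where i: "UNIV = {i1, i2, b w}" "distinct [i1, i2, b w]"
        and le: "\<bar>c i2\<bar> \<le> \<bar>c i1\<bar>" "\<bar>c (b w)\<bar> \<le> \<bar>c i2\<bar>"
      using decreasing_order_of_3[of "\<lambda>i. \<bar>c i\<bar>" "b w"] b_min by blast
    define x y z where "x = \<bar>c i1\<bar>" and "y = \<bar>c i2\<bar>" and "z = \<bar>c (b w)\<bar>"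
    have xyz: "0 < z" "z \<le> y" "y \<le> x" "x \<le> 1" using le c by (auto simp: x_def y_def z_def)
    have alpha: "alpha S 1 w = x" "alpha S 2 w = y" "alpha S 3 w = z"
      using alpha_monomial_affine[OF f i le] by (auto simp: x_def y_def z_def)
    \<comment> \<open>If \<open>x = y\<close>, then \<open>a w\<close> and \<open>i1\<close> may differ, but the base of both powers is \<open>1\<close>.\<close>
    have p1: "(x / y) powr real_of_ereal (quasi_Assouad_dim (axis_proj i1 ` F)) = (x / y) powr p1_bar F a w"
    proof (cases "x = y")
      case False
      then have "a w \<noteq> i2" "a w \<noteq> b w"
        using a_max[of i1] xyz by (auto simp: x_def y_def z_def)
      then have "a w = i1" using i(1) by blast
      then show ?thesis by (simp add: p1_bar_def)
    qed (use xyz in simp)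
    define s1 s2 where "s1 = p1_bar F a w" and "s2 = p2_bar F b w"
    define \<rho> where "\<rho> = z / 4"
    define N where "N = C1 * (x / y) powr s1 * (4 powr \<eta> * z powr - \<eta>)"
    have axis: "real (covering_number (\<rho> / \<bar>c i1\<bar>)
        (ball (axis_proj (\<tau> i1) v) (2 * (\<rho> / \<bar>c i2\<bar>)) \<inter> axis_proj (\<tau> i1) ` F)) \<le> N" if v: "v \<in> F" for v
    proof -
      have "real (covering_number (\<rho> / \<bar>c i1\<bar>)
          (ball (axis_proj (\<tau> i1) v) (2 * (\<rho> / \<bar>c i2\<bar>)) \<inter> axis_proj (\<tau> i1) ` F))
        \<le> C1 * ((\<rho> / \<bar>c i2\<bar>) / (\<rho> / \<bar>c i1\<bar>)) powr real_of_ereal (quasi_Assouad_dim (axis_proj i1 ` F))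
            * (\<rho> / \<bar>c i1\<bar>) powr - \<eta>"
        using xyz by (intro C1[OF word(2) f v]) (auto simp: \<rho>_def x_def y_def divide_simps)
      also have "(\<rho> / \<bar>c i2\<bar>) / (\<rho> / \<bar>c i1\<bar>) = x / y"
        using xyz by (simp add: \<rho>_def x_def y_def)
      also have "(x / y) powr real_of_ereal (quasi_Assouad_dim (axis_proj i1 ` F)) = (x / y) powr s1"
        unfolding s1_def by (rule p1)
      also have "C1 * (x / y) powr s1 * (\<rho> / \<bar>c i1\<bar>) powr - \<eta> \<le> C1 * (x / y) powr s1 * \<rho> powr - \<eta>"
        using xyz \<eta> \<open>0 < C1\<close> c[of i1] by (intro mult_left_mono powr_mono2') (auto simp: \<rho>_def field_simps)
      also have "\<rho> powr - \<eta> = 4 powr \<eta> * z powr - \<eta>"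
        using xyz by (simp add: \<rho>_def powr_divide powr_minus divide_simps)
      finally show ?thesis by (simp add: N_def)
    qed
    have plane: "real (covering_number (\<rho> / \<bar>c i2\<bar>) (plane_proj (\<tau> (b w)) ` F))
        \<le> C2 * ((y / z) powr s2 * z powr - \<eta>)"
    proof -
      have "\<rho> / \<bar>c i2\<bar> = (z / y) / 4" by (simp add: \<rho>_def y_def)
      then have "real (covering_number (\<rho> / \<bar>c i2\<bar>) (plane_proj (\<tau> (b w)) ` F))
          \<le> C2 * (z / y) powr - (s2 + \<eta>)"
        using C2[OF word(2) f, of "z / y" "b w"] xyz by (simp add: s2_def p2_bar_def)
      also have "(z / y) powr - (s2 + \<eta>) = (y / z) powr s2 * (z / y) powr - \<eta>"
        using xyz by (simp add: powr_diff powr_divide powr_minus divide_simps powr_add)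
      also have "C2 * ((y / z) powr s2 * (z / y) powr - \<eta>) \<le> C2 * ((y / z) powr s2 * z powr - \<eta>)"
        using xyz \<eta> \<open>0 < C2\<close> by (intro mult_left_mono powr_mono2') (auto simp: field_simps)
      finally show ?thesis .
    qed
    have "0 \<le> N" using \<open>0 < C1\<close> by (simp add: N_def)
    have bounded: "bounded (word_map S w ` F)"
      using word_map_attractor[OF assms(2) word(2)] F(1) by (rule bounded_subset[rotated])
    have "real (covering_number \<delta> (word_map S w ` F)) \<le> real (covering_number \<rho> (word_map S w ` F))"
      using word(3) xyz alpha unfolding of_nat_le_iff
      by (intro covering_number_antimono[OF bounded]) (auto simp: \<rho>_def)
    also have "\<dots> \<le> real (covering_number (\<rho> / \<bar>c i2\<bar>) (plane_proj (\<tau> (b w)) ` F)) * (N * k)"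
      unfolding k_def
      by (rule covering_number_monomial_affine_le[OF f i F L _ _ axis]) (use xyz in \<open>auto simp: \<rho>_def z_def\<close>)
    also have "\<dots> \<le> C2 * ((y / z) powr s2 * z powr - \<eta>) * (N * k)"
      using plane \<open>0 \<le> N\<close> \<open>0 < k\<close> by (intro mult_right_mono) auto
    also have "\<dots> = K * (x / y) powr s1 * (y / z) powr s2 * (z powr - \<eta> * z powr - \<eta>)"
      by (simp add: K_def N_def mult_ac)
    also have "z powr - \<eta> * z powr - \<eta> = z powr - \<epsilon>"
      using xyz by (simp add: powr_add[symmetric] \<eta>_def)
    finally show ?thesis unfolding alpha s1_def s2_def .
  qed
  with \<open>0 < K\<close> show ?thesis by blast
qed

end
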